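(* Let $m,n\ge 1$ and $1\le k\le m$ be integers and let $B\in M_{m,n}$. Put $Z=\mathrm{vec}(B)\in\mathbb{C}^{mn}$, regard $ZZ^*$ as an element of $M_n(M_m)$, and define \[\gamma_k^{\pm}=\max_{\substack{V\in M_{m,k}\\ V^*V=I_k}}\lambda_{\max}\big((I_n\otimes V)^*(\mp ZZ^* )^{\tau}(I_n\otimes V)\big)\] (upper signs go together and lower signs go together). Then: (a) If $m,n\ge 2$, then $\gamma_k^+=0$ when $k=1$ or $\mathrm{rank}(B)\le 1$, and $\gamma_k^+=\sigma_1(B)\sigma_2(B)$ otherwise. (b) $\gamma_k^-=\sigma_1(B)^2$.
   Context: $M_{m,n}$ is the set of $m\times n$ complex matrices. For $X\in M_{m,n}$ with columns $x_1,\ldots,x_n$, $\mathrm{vec}(X)\in\mathbb{C}^{mn}$ is the column vector obtained by stacking $x_1,\ldots,x_n$. For a block matrix $A=[A_{ij}]_{i,j=1}^n\in M_n(M_m)$ ($n\times n$ blocks, each $A_{ij}\in M_m$), the partial transpose is $A^\tau=[A_{ji}]_{i,j=1}^n$ (blocks are swapped but not themselves transposed). $\lambda_{\max}(H)$ is the largest eigenvalue of a Hermitian matrix $H$. Singular values of $B$ are $\sigma_1(B)\ge\sigma_2(B)\ge\cdots\ge\sigma_{\min\{m,n\}}(B)\ge 0$. *)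

theory Defs
  imports
    "HOL-Computational_Algebra.Fundamental_Theorem_Algebra"
    "Jordan_Normal_Form.Schur_Decomposition"
    "Jordan_Normal_Form.DL_Rank"
begin

text \<open>All indices are 0-based, as in the matrix library. An \<open>n \<times> n\<close> block matrix with blocks of
  size \<open>m \<times> m\<close> is a matrix in \<open>carrier_mat (n * m) (n * m)\<close>: row (or column) \<open>i * m + r\<close>, with
  \<open>r < m\<close>, is row (or column) \<open>r\<close> inside the block row (or block column) \<open>i\<close>.\<close>

definition vec_of_mat :: "'a mat \<Rightarrow> 'a vec" where
  "vec_of_mat X = vec (dim_col X * dim_row X) (\<lambda>a. X $$ (a mod dim_row X, a div dim_row X))"

text \<open>The rank-one matrix \<open>z z\<^sup>*\<close>, with \<open>z\<close> read as a one-column matrix.\<close>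

definition outer_self :: "complex vec \<Rightarrow> complex mat" where
  "outer_self z = mat_of_cols (dim_vec z) [z] * mat_adjoint (mat_of_cols (dim_vec z) [z])"

text \<open>Entry \<open>(r, s)\<close> of block \<open>(i, j)\<close> of the partial transpose is entry \<open>(r, s)\<close> of block \<open>(j, i)\<close>
  of \<open>A\<close>.\<close>

definition partial_transpose :: "nat \<Rightarrow> nat \<Rightarrow> 'a mat \<Rightarrow> 'a mat" where
  "partial_transpose n m A = mat (n * m) (n * m)
     (\<lambda>(a, b). A $$ ((b div m) * m + a mod m, (a div m) * m + b mod m))"

definition kronecker :: "'a :: times mat \<Rightarrow> 'a mat \<Rightarrow> 'a mat" where
  "kronecker A B = mat (dim_row A * dim_row B) (dim_col A * dim_col B)
     (\<lambda>(a, b). A $$ (a div dim_row B, b div dim_col B) * B $$ (a mod dim_row B, b mod dim_col B))"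

text \<open>Meant for Hermitian matrices of positive size, all of whose eigenvalues are real.\<close>

definition lambda_max :: "complex mat \<Rightarrow> real" where
  "lambda_max H = Max {r. eigenvalue H (complex_of_real r)}"

text \<open>The nonnegative square roots of the eigenvalues of \<open>B\<^sup>* B\<close>, with algebraic multiplicity, in
  decreasing order. Only the first \<open>min m n\<close> of the \<open>n\<close> values count (any others are 0). The
  eigenvalues are real and nonnegative, so \<open>Re\<close> is only a type conversion.\<close>

definition singular_values :: "complex mat \<Rightarrow> real list" where
  "singular_values B = take (min (dim_row B) (dim_col B))
     (rev (sorted_list_of_multiset
       (image_mset (\<lambda>x. sqrt (Re x)) (proots (char_poly (mat_adjoint B * B))))))"

text \<open>The customary 1-based numbering: \<open>singular_value B 1\<close> is the largest singular value.\<close>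

definition singular_value :: "complex mat \<Rightarrow> nat \<Rightarrow> real" where
  "singular_value B i = singular_values B ! (i - 1)"

text \<open>A genuine maximum over an infinite set, hence \<open>GREATEST\<close> rather than \<open>Max\<close>, which is
  only specified on finite sets.\<close>

definition gamma_max :: "nat \<Rightarrow> nat \<Rightarrow> nat \<Rightarrow> complex mat \<Rightarrow> real" where
  "gamma_max m n k A = (GREATEST x. \<exists>V \<in> carrier_mat m k. mat_adjoint V * V = 1\<^sub>m k \<and>
     x = lambda_max (mat_adjoint (kronecker (1\<^sub>m n) V) * partial_transpose n m A
                       * kronecker (1\<^sub>m n) V))"

text \<open>The upper sign goes with the minus sign: \<open>\<gamma>\<^sup>+\<close> belongs to \<open>- Z Z\<^sup>*\<close>, \<open>\<gamma>\<^sup>-\<close> to \<open>Z Z\<^sup>*\<close>.\<close>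

definition gamma_plus :: "nat \<Rightarrow> complex mat \<Rightarrow> real" where
  "gamma_plus k B = gamma_max (dim_row B) (dim_col B) k (- outer_self (vec_of_mat B))"

definition gamma_minus :: "nat \<Rightarrow> complex mat \<Rightarrow> real" where
  "gamma_minus k B = gamma_max (dim_row B) (dim_col B) k (outer_self (vec_of_mat B))"

end

theory Submission
  imports Defs "Jordan_Normal_Form.Spectral_Radius"
begin

text \<open>Write \<open>C = V\<^sup>* B\<close>. Under \<open>vec\<close>, the compressed partial transpose of \<open>Z Z\<^sup>*\<close> acts on
  \<open>k \<times> n\<close> matrices as \<open>Y \<mapsto> C Y\<^sup>T cnj C\<close>. For unitary \<open>U\<close>, passing to \<open>Y cnj U\<close> replaces \<open>C\<close> by
  \<open>C U\<close>, so one may use right singular vectors of \<open>B\<close>: \<open>C U = V\<^sup>* W diag s\<close>, where \<open>W\<close> has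
  orthonormal (or zero) columns. With \<open>z = Y\<^sup>* V\<^sup>* W\<close>, an eigenvalue \<open>\<mu>\<close> of the compression satisfies
  \<open>\<mu> \<parallel>Y\<parallel>\<^sup>2 = \<plusminus> (\<Sum>a b. s\<^sub>a s\<^sub>b z\<^sub>a\<^sub>b cnj z\<^sub>b\<^sub>a)\<close> and \<open>\<parallel>z\<parallel> \<le> \<parallel>Y\<parallel>\<close> by Bessel. The arithmetic-geometric mean
  inequality gives the bound \<open>s\<^sub>0\<^sup>2\<close> for the plus sign; for the minus sign the diagonal terms are
  nonpositive, which leaves \<open>s\<^sub>0 s\<^sub>1\<close>. Both bounds are attained when the first columns of \<open>V\<close> are
  those of \<open>W\<close>, by \<open>E\<^sub>0\<^sub>0\<close> and \<open>E\<^sub>0\<^sub>1 - E\<^sub>1\<^sub>0\<close> respectively. For \<open>k = 1\<close> the double sum over the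
  entries is a squared modulus.\<close>

subsection \<open>Adjoints and isometries\<close>

lemma dim_mat_adjoint [simp]:
  "dim_row (mat_adjoint A) = dim_col A" "dim_col (mat_adjoint A) = dim_row A"
  by (auto simp: mat_adjoint_def)

lemma mat_adjoint_carrier [simp, intro]: "A \<in> carrier_mat m n \<Longrightarrow> mat_adjoint A \<in> carrier_mat n m"
  by (metis carrier_matD carrier_matI dim_mat_adjoint)

lemma index_mat_adjoint [simp]:
  "i < dim_col A \<Longrightarrow> j < dim_row A \<Longrightarrow> mat_adjoint A $$ (i, j) = conjugate (A $$ (j, i))"
  by (simp add: mat_adjoint_def mat_of_rows_index)

lemma mat_adjoint_adjoint [simp]: "mat_adjoint (mat_adjoint A) = (A :: complex mat)"
  by (rule eq_matI) auto

lemma index_mult_mat_sum: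
  "i < dim_row A \<Longrightarrow> j < dim_col B \<Longrightarrow> dim_col A = dim_row B \<Longrightarrow>
     (A * B) $$ (i, j) = (\<Sum>l<dim_row B. A $$ (i, l) * B $$ (l, j))"
  by (auto simp: scalar_prod_def lessThan_atLeast0 intro!: sum.cong)

lemma mult_mat_assoc_dim:
  "dim_col A = dim_row B \<Longrightarrow> dim_col B = dim_row C \<Longrightarrow> (A * B) * C = A * (B * (C :: 'a :: semiring_0 mat))"
  by (rule assoc_mult_mat) auto

lemma mat_adjoint_mult:
  fixes A B :: "complex mat"
  assumes "dim_col A = dim_row B"
  shows "mat_adjoint (A * B) = mat_adjoint B * mat_adjoint A"
  by (rule eq_matI) (use assms in \<open>auto simp del: index_mult_mat(1) simp add: index_mult_mat_sum mult.commute\<close>)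

section \<open>Unitary matrices and the extension of isometries\<close>

lemma unitary_comm:
  fixes U :: "complex mat"
  assumes "U \<in> carrier_mat n n" "mat_adjoint U * U = 1\<^sub>m n"
  shows "U * mat_adjoint U = 1\<^sub>m n"
  using mat_mult_left_right_inverse[OF _ assms(1) assms(2)] assms(1) by auto

text \<open>Zero rows pad the system to a square one. Its last row is zero because
  \<open>j < m\<close>, so the determinant vanishes and the kernel is nontrivial.\<close>

lemma homogeneous_system_nontrivial:
  fixes A :: "'a :: field mat"
  assumes A: "A \<in> carrier_mat j m" and "j < m"
  shows "\<exists>x \<in> carrier_vec m. x \<noteq> 0\<^sub>v m \<and> A *\<^sub>v x = 0\<^sub>v j"
proof -
  define A' where "A' = mat m m (\<lambda>(r, c). if r < j then A $$ (r, c) else 0)"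
  have A': "A' \<in> carrier_mat m m" by (auto simp: A'_def)
  have "row A' (m - 1) = 0\<^sub>v m"
    by (rule eq_vecI) (use assms in \<open>auto simp: A'_def\<close>)
  hence "A' = mat\<^sub>r m m (\<lambda>r. if r = m - 1 then 0\<^sub>v m else row A' r)"
    using A' \<open>row A' (m - 1) = 0\<^sub>v m\<close> by (intro eq_matI) (auto simp flip: index_row(1))
  hence "det A' = 0"
    using det_row_0[of "m - 1" m "\<lambda>r. row A' r"] assms A' by auto
  then obtain x where x: "x \<in> carrier_vec m" "x \<noteq> 0\<^sub>v m" "A' *\<^sub>v x = 0\<^sub>v m"
    using det_0_iff_vec_prod_zero[OF A'] by auto
  have "A *\<^sub>v x = 0\<^sub>v j"
  proof (rule eq_vecI)
    fix r assume "r < dim_vec (0\<^sub>v j :: 'a vec)"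
    hence r: "r < j" by simp
    hence "row A' r = row A r" using assms by (intro eq_vecI) (auto simp: A'_def)
    hence "(A *\<^sub>v x) $ r = (A' *\<^sub>v x) $ r" using r assms(2) carrier_matD[OF A] carrier_matD[OF A'] by simp
    thus "(A *\<^sub>v x) $ r = 0\<^sub>v j $ r" using x(3) r assms(2) by simp
  qed (use A in auto)
  with x show ?thesis by blast
qed

lemma index_adjoint_mult:
  fixes A B :: "complex mat"
  assumes "i < dim_col A" "j < dim_col B" "dim_row A = dim_row B"
  shows "(mat_adjoint A * B) $$ (i, j) = (\<Sum>l<dim_row B. cnj (A $$ (l, i)) * B $$ (l, j))"
  using assms by (subst index_mult_mat_sum) auto

text \<open>The new column is a normalised solution of
  \<open>mat_adjoint V *\<^sub>v x = 0\<^sub>v j\<close>, a system with fewer equations than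
  unknowns.\<close>

lemma isometry_extension_step:
  fixes V :: "complex mat"
  assumes V: "V \<in> carrier_mat m j" "mat_adjoint V * V = 1\<^sub>m j" and "j < m"
  shows "\<exists>W \<in> carrier_mat m (Suc j). mat_adjoint W * W = 1\<^sub>m (Suc j) \<and>
           (\<forall>r<m. \<forall>i<j. W $$ (r, i) = V $$ (r, i))"
proof -
  have "mat_adjoint V \<in> carrier_mat j m" using V by auto
  from homogeneous_system_nontrivial[OF this \<open>j < m\<close>] obtain x where
    x: "x \<in> carrier_vec m" "x \<noteq> 0\<^sub>v m" "mat_adjoint V *\<^sub>v x = 0\<^sub>v j" by auto
  define N where "N = (\<Sum>r<m. (cmod (x $ r))\<^sup>2)"
  obtain r0 where r0: "r0 < m" "x $ r0 \<noteq> 0" using x by (metis carrier_vecD eq_vecI index_zero_vec)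
  have "(cmod (x $ r0))\<^sup>2 \<le> N" unfolding N_def using r0 by (intro member_le_sum) auto
  hence N: "N > 0" using r0 by (smt (verit) norm_eq_zero zero_less_power2)
  define W where "W = mat m (Suc j) (\<lambda>(r, i). if i < j then V $$ (r, i) else x $ r / sqrt N)"
  have W: "W \<in> carrier_mat m (Suc j)" by (simp add: W_def)
  have VV: "(\<Sum>r<m. cnj (V $$ (r, a)) * V $$ (r, b)) = (if a = b then 1 else 0)"
    if "a < j" "b < j" for a b
    using index_adjoint_mult[of a V b V] V that by simp
  have Vx: "(\<Sum>r<m. cnj (V $$ (r, a)) * x $ r) = 0" if "a < j" for a
    using arg_cong[OF x(3), of "\<lambda>v. v $ a"] that V(1) x(1)
    by (simp add: scalar_prod_def lessThan_atLeast0)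
  have xV: "(\<Sum>r<m. cnj (x $ r) * V $$ (r, a)) = 0" if "a < j" for a
    using arg_cong[OF Vx[OF that], of cnj] by (simp add: mult.commute)
  have xx: "(\<Sum>r<m. cnj (x $ r) * x $ r) = of_real N"
    unfolding N_def of_real_sum by (intro sum.cong) (auto simp: complex_norm_square mult.commute simp del: of_real_power)
  have "mat_adjoint W * W = 1\<^sub>m (Suc j)"
  proof (rule eq_matI)
    fix a b assume "a < dim_row (1\<^sub>m (Suc j) :: complex mat)" "b < dim_col (1\<^sub>m (Suc j) :: complex mat)"
    hence ab: "a < Suc j" "b < Suc j" by auto
    have "(mat_adjoint W * W) $$ (a, b) = (\<Sum>r<m. cnj (W $$ (r, a)) * W $$ (r, b))"
      using W ab by (subst index_adjoint_mult) auto
    also have "\<dots> = (if a = b then 1 else 0)"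
    proof -
      consider "a < j" "b < j" | "a < j" "b = j" | "a = j" "b < j" | "a = j" "b = j"
        using ab by linarith
      then show ?thesis
      proof cases
        case 1
        then show ?thesis using VV[of a b] by (simp add: W_def)
      next
        case 2
        then show ?thesis using Vx[of a] by (simp add: W_def flip: sum_divide_distrib)
      next
        case 3
        then show ?thesis using xV[of b] by (simp add: W_def flip: sum_divide_distrib)
      next
        case 4
        have "of_real (sqrt N) * of_real (sqrt N) = (of_real N :: complex)"
          using N by (simp flip: of_real_mult)
        then show ?thesis using 4 xx N by (simp add: W_def flip: sum_divide_distrib)
      qed
    qed
    finally show "(mat_adjoint W * W) $$ (a, b) = 1\<^sub>m (Suc j) $$ (a, b)" using ab by simp
  qed (use W in auto)
  moreover have "\<forall>r<m. \<forall>i<j. W $$ (r, i) = V $$ (r, i)" by (simp add: W_def)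
  ultimately show ?thesis using W by blast
qed

text \<open>Serves two purposes: completing a unit eigenvector to a unitary matrix, and building an
  admissible \<open>V\<close> whose first columns are prescribed left singular vectors.\<close>

lemma isometry_extension:
  fixes V :: "complex mat"
  assumes "j \<le> k" "k \<le> m"
    and "V \<in> carrier_mat m j" "mat_adjoint V * V = 1\<^sub>m j"
  shows "\<exists>W \<in> carrier_mat m k. mat_adjoint W * W = 1\<^sub>m k \<and>
           (\<forall>r<m. \<forall>i<j. W $$ (r, i) = V $$ (r, i))"
  using assms
proof (induction k rule: dec_induct)
  case base
  then show ?case by auto
next
  case (step k)
  then obtain W where W: "W \<in> carrier_mat m k" "mat_adjoint W * W = 1\<^sub>m k"
    "\<forall>r<m. \<forall>i<j. W $$ (r, i) = V $$ (r, i)" by auto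
  from isometry_extension_step[OF W(1,2)] step W(3) show ?case
    by (metis Suc_le_lessD order_less_le_trans)
qed

section \<open>Unitary diagonalization of Hermitian matrices\<close>

lemma adjoint_four_block_one:
  fixes P :: "complex mat"
  assumes "P \<in> carrier_mat n n"
  defines "R \<equiv> four_block_mat (1\<^sub>m 1) (0\<^sub>m 1 n) (0\<^sub>m n 1) P"
  shows "mat_adjoint R = four_block_mat (1\<^sub>m 1) (0\<^sub>m 1 n) (0\<^sub>m n 1) (mat_adjoint P)"
  unfolding R_def using assms(1) by (intro eq_matI) auto

lemma mult_block_diag_mat:
  fixes A B C D :: "'a :: comm_ring_1 mat"
  assumes "A \<in> carrier_mat p p" "C \<in> carrier_mat p p" "B \<in> carrier_mat n n" "D \<in> carrier_mat n n"
  shows "four_block_mat A (0\<^sub>m p n) (0\<^sub>m n p) B * four_block_mat C (0\<^sub>m p n) (0\<^sub>m n p) D =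
         four_block_mat (A * C) (0\<^sub>m p n) (0\<^sub>m n p) (B * D)"
  using assms by (subst mult_four_block_mat[of _ p p _ n _ n _ _ p _ n]) auto

text \<open>Deflation by one unit eigenvector at a time, by induction on \<open>es\<close>. The
  eigenvalues may be listed in any order, which later allows sorting them by decreasing singular
  value.\<close>

lemma Hermitian_unitary_diagonalization:
  fixes A :: "complex mat"
  assumes "A \<in> carrier_mat n n" "mat_adjoint A = A" "char_poly A = (\<Prod>e\<leftarrow>es. [:- e, 1:])"
  shows "\<exists>U \<in> carrier_mat n n. mat_adjoint U * U = 1\<^sub>m n \<and>
    mat_adjoint U * A * U = mat n n (\<lambda>(i, j). if i = j then es ! i else 0)"
  using assms
proof (induction es arbitrary: A n)
  case Nil
  with degree_monic_char_poly[of A n] have "n = 0" by auto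
  with Nil show ?case by (intro bexI[of _ "1\<^sub>m 0"]) auto
next
  case (Cons e es A n')
  have "degree (char_poly A) = Suc (length es)"
    unfolding Cons.prems using degree_linear_factors[of uminus "e # es"] by simp
  with degree_monic_char_poly[OF Cons.prems(1)] have "n' = Suc (length es)" by simp
  then obtain n where n': "n' = Suc n" by simp
  note A = Cons.prems(1)[unfolded n']
  have "eigenvalue A e"
    unfolding eigenvalue_root_char_poly[OF A] Cons.prems(3) by simp
  then obtain v where v: "v \<in> carrier_vec (Suc n)" "v \<noteq> 0\<^sub>v (Suc n)" "A *\<^sub>v v = e \<cdot>\<^sub>v v"
    using A by (auto simp: eigenvalue_def eigenvector_def)
  define N where "N = (\<Sum>r<Suc n. (cmod (v $ r))\<^sup>2)"
  obtain r0 where r0: "r0 < Suc n" "v $ r0 \<noteq> 0" using v by (metis carrier_vecD eq_vecI index_zero_vec)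
  have "(cmod (v $ r0))\<^sup>2 \<le> N" unfolding N_def using r0 by (intro member_le_sum) auto
  hence N: "N > 0" using r0 by (smt (verit) norm_eq_zero zero_less_power2)
  define V where "V = mat (Suc n) 1 (\<lambda>(r, i). v $ r / sqrt N)"
  have V: "V \<in> carrier_mat (Suc n) 1" by (simp add: V_def)
  have vv: "(\<Sum>r<Suc n. cnj (v $ r) * v $ r) = of_real N"
    unfolding N_def of_real_sum by (intro sum.cong) (auto simp: complex_norm_square mult.commute simp del: of_real_power)
  have sN: "of_real (sqrt N) * of_real (sqrt N) = (of_real N :: complex)"
    using N by (simp flip: of_real_mult)
  have "mat_adjoint V * V = 1\<^sub>m 1"
  proof (rule eq_matI)
    fix i j assume "i < dim_row (1\<^sub>m 1 :: complex mat)" "j < dim_col (1\<^sub>m 1 :: complex mat)"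
    then show "(mat_adjoint V * V) $$ (i, j) = 1\<^sub>m 1 $$ (i, j)"
      using vv N sN by (subst index_adjoint_mult) (auto simp: V_def simp del: sum.lessThan_Suc simp flip: sum_divide_distrib)
  qed (use V in auto)
  \<comment> \<open>The one-column matrix \<open>V\<close> grows into a unitary matrix whose first
    column is the unit eigenvector.\<close>
  from isometry_extension[OF _ order.refl V this] obtain W where
    W: "W \<in> carrier_mat (Suc n) (Suc n)" "mat_adjoint W * W = 1\<^sub>m (Suc n)"
       "\<forall>r<Suc n. W $$ (r, 0) = V $$ (r, 0)" by auto
  note WW = unitary_comm[OF W(1,2)]
  have W': "mat_adjoint W \<in> carrier_mat (Suc n) (Suc n)" using W by auto
  define A' where "A' = mat_adjoint W * A * W"
  have A': "A' \<in> carrier_mat (Suc n) (Suc n)" using A W by (auto simp: A'_def)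
  have adj: "mat_adjoint A' = A'"
    unfolding A'_def using A W W' Cons.prems(2) by (simp add: mat_adjoint_mult assoc_mult_mat[of _ "Suc n" "Suc n" _ "Suc n" _ "Suc n"])
  have "col W 0 = (1 / sqrt N) \<cdot>\<^sub>v v"
    using W v by (intro eq_vecI) (auto simp: V_def)
  hence "A *\<^sub>v col W 0 = e \<cdot>\<^sub>v col W 0"
    using v A by (simp add: mult_mat_vec[of _ "Suc n" "Suc n"] smult_smult_assoc mult.commute)
  have "col A' 0 = mat_adjoint W *\<^sub>v (A *\<^sub>v col W 0)"
    unfolding A'_def col_mult2[OF mult_carrier_mat[OF W' A] W(1) zero_less_Suc]
    by (rule assoc_mult_mat_vec[OF W' A]) (use W(1) in \<open>auto intro!: col_carrier_vec\<close>)
  also have "\<dots> = e \<cdot>\<^sub>v (mat_adjoint W *\<^sub>v col W 0)"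
    unfolding \<open>A *\<^sub>v col W 0 = e \<cdot>\<^sub>v col W 0\<close>
    using W W' by (intro mult_mat_vec[of _ "Suc n" "Suc n"]) (auto intro!: col_carrier_vec)
  also have "mat_adjoint W *\<^sub>v col W 0 = col (1\<^sub>m (Suc n)) 0"
    unfolding W(2)[symmetric] by (subst col_mult2[OF W' W(1)]) auto
  finally have col0: "col A' 0 = e \<cdot>\<^sub>v col (1\<^sub>m (Suc n)) 0" .
  have A'0: "A' $$ (i, 0) = (if i = 0 then e else 0)" if "i < Suc n" for i
    using arg_cong[OF col0, of "\<lambda>v. v $ i"] that A' by auto
  \<comment> \<open>\<open>A'\<close> is Hermitian, so the zeros below its corner reappear to the
    right of it, and \<open>A'\<close> splits into blocks.\<close>
  have A'0': "A' $$ (0, i) = (if i = 0 then e else 0)" if "i < Suc n" for i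
  proof (cases "i = 0")
    case False
    have "mat_adjoint A' $$ (0, i) = cnj (A' $$ (i, 0))" using that A' by simp
    then show ?thesis using A'0[OF that] False by (simp add: adj)
  qed (use A'0[of 0] in simp)
  define A3 where "A3 = mat n n (\<lambda>(i, j). A' $$ (Suc i, Suc j))"
  have A3: "A3 \<in> carrier_mat n n" by (simp add: A3_def)
  define A1 where "A1 = mat 1 1 (\<lambda>_. e)"
  have A1: "A1 \<in> carrier_mat 1 1" by (simp add: A1_def)
  have A'_block: "A' = four_block_mat A1 (0\<^sub>m 1 n) (0\<^sub>m n 1) A3"
    using A' by (intro eq_matI) (auto simp: A1_def A3_def A'0 A'0')
  \<comment> \<open>Unitary similarity preserves the characteristic polynomial; cancelling the
    factor of \<open>e\<close> leaves \<open>A3\<close> with exactly the remaining list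
    \<open>es\<close>.\<close>
  have "similar_mat_wit A' A (mat_adjoint W) W"
    by (rule similar_mat_witI[of _ _ "Suc n"]) (use W W' WW A A' in \<open>auto simp: A'_def\<close>)
  hence "char_poly A' = char_poly A" by (intro char_poly_similar) (auto simp: similar_mat_def)
  moreover have "char_poly A' = char_poly A1 * char_poly A3" 
    unfolding A'_block by (rule char_poly_four_block_zeros_col[OF A1 _ A3]) auto
  moreover have "char_poly A1 = [: -e,1 :]"
    by (simp add: A1_def char_poly_defs det_def sign_def)
  ultimately have "[:- e, 1:] * char_poly A3 = [:- e, 1:] * (\<Prod>e\<leftarrow>es. [:- e, 1:])"
    using Cons.prems(3) by simp
  hence "char_poly A3 = (\<Prod>e\<leftarrow>es. [:- e, 1:])"
    unfolding mult_cancel_left by simp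
  moreover have "mat_adjoint A3 = A3"
  proof (rule eq_matI)
    fix i j assume "i < dim_row A3" "j < dim_col A3"
    hence "i < n" "j < n" by (auto simp: A3_def)
    then have "mat_adjoint A' $$ (Suc i, Suc j) = cnj (A' $$ (Suc j, Suc i))" using A' by simp
    with \<open>i < n\<close> \<open>j < n\<close> show "mat_adjoint A3 $$ (i, j) = A3 $$ (i, j)" by (simp add: adj A3_def)
  qed (auto simp: A3_def)
  ultimately obtain P where P: "P \<in> carrier_mat n n" "mat_adjoint P * P = 1\<^sub>m n"
    "mat_adjoint P * A3 * P = mat n n (\<lambda>(i, j). if i = j then es ! i else 0)"
    using Cons.IH[OF A3] by auto
  have P': "mat_adjoint P \<in> carrier_mat n n" using P by auto
  define R where "R = four_block_mat (1\<^sub>m 1) (0\<^sub>m 1 n) (0\<^sub>m n 1) P"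
  have R: "R \<in> carrier_mat (Suc n) (Suc n)" using P by (auto simp: R_def)
  have adjR: "mat_adjoint R = four_block_mat (1\<^sub>m 1) (0\<^sub>m 1 n) (0\<^sub>m n 1) (mat_adjoint P)"
    unfolding R_def by (rule adjoint_four_block_one[OF P(1)])
  have R': "mat_adjoint R \<in> carrier_mat (Suc n) (Suc n)" using R by auto
  have RR: "mat_adjoint R * R = 1\<^sub>m (Suc n)"
    unfolding adjR unfolding R_def
    by (subst mult_four_block_mat[of _ 1 1 _ n _ n _ _ 1 _ n])
       (use P P' in \<open>auto intro!: eq_matI\<close>)
  have RAR: "mat_adjoint R * A' * R =
     four_block_mat A1 (0\<^sub>m 1 n) (0\<^sub>m n 1) (mat_adjoint P * A3 * P)"
    unfolding adjR A'_block unfolding R_def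
    using P(1) P' A1 A3 mult_carrier_mat[OF P' A3] by (simp add: mult_block_diag_mat del: assoc_mult_mat)
  \<comment> \<open>\<open>W\<close> splits off the first eigenvector; \<open>R\<close> diagonalises
    the remaining block and fixes the corner.\<close>
  define U where "U = W * R"
  have U: "U \<in> carrier_mat (Suc n) (Suc n)" using W R by (auto simp: U_def)
  have "mat_adjoint U * U = mat_adjoint R * (mat_adjoint W * W) * R"
    unfolding U_def using carrier_matD[OF W(1)] carrier_matD[OF R]
    by (simp add: mat_adjoint_mult mult_mat_assoc_dim)
  also have "\<dots> = 1\<^sub>m (Suc n)" unfolding W(2) using R' RR by (simp add: right_mult_one_mat[OF R'])
  finally have UU: "mat_adjoint U * U = 1\<^sub>m (Suc n)" .
  have "mat_adjoint U * A * U = mat_adjoint R * A' * R"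
    unfolding U_def A'_def using carrier_matD[OF W(1)] carrier_matD[OF R] carrier_matD[OF A]
    by (simp add: mat_adjoint_mult mult_mat_assoc_dim)
  also have "\<dots> = mat (Suc n) (Suc n) (\<lambda>(i, j). if i = j then (e # es) ! i else 0)"
    unfolding RAR P(3) by (rule eq_matI) (auto simp: A1_def nth_Cons split: nat.split)
  finally show ?case using U UU unfolding n' by blast
qed

subsection \<open>Vectorisation, partial transpose and compression\<close>

lemma block_div: "r < m \<Longrightarrow> (i * m + r) div m = (i :: nat)"
  by simp

lemma block_mod: "r < m \<Longrightarrow> (i * m + r) mod m = (r :: nat)"
  by simp

lemma block_index_less:
  fixes i :: nat
  assumes "i < n" "r < m"
  shows "i * m + r < n * m"
proof -
  have "i * m + r < Suc i * m" using assms by simp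
  also have "\<dots> \<le> n * m" using assms by (intro mult_le_mono1) auto
  finally show ?thesis .
qed

text \<open>Turns the sums of matrix-vector products with flattened block indices into double sums
  over matrix entries.\<close>

lemma sum_div_mod:
  fixes f :: "nat \<Rightarrow> nat \<Rightarrow> 'a :: comm_monoid_add"
  shows "(\<Sum>b<n * k. f (b div k) (b mod k)) = (\<Sum>i<n. \<Sum>r<k. f i r)"
proof -
  have "(\<Sum>b<n * k. f (b div k) (b mod k)) = (\<Sum>i<n. \<Sum>b\<in>{i * k..<i * k + k}. f (b div k) (b mod k))"
    by (rule sum.nat_group[symmetric])
  also have "\<dots> = (\<Sum>i<n. \<Sum>r<k. f i r)"
  proof (rule sum.cong[OF refl])
    fix i assume "i \<in> {..<n}"
    show "(\<Sum>b\<in>{i * k..<i * k + k}. f (b div k) (b mod k)) = (\<Sum>r<k. f i r)"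
      by (rule sum.reindex_bij_witness[of _ "\<lambda>r. i * k + r" "\<lambda>b. b - i * k"])
         (auto simp: block_div block_mod le_iff_add)
  qed
  finally show ?thesis .
qed

lemma div_mod_less:
  fixes a :: nat
  assumes "a < n * m"
  shows "a div m < n" "a mod m < m"
  using assms by (auto simp: less_mult_imp_div_less) (metis mod_less_divisor mult_0_right not_less_zero gr0I)

lemma vec_of_mat_carrier: "X \<in> carrier_mat m n \<Longrightarrow> vec_of_mat X \<in> carrier_vec (n * m)"
  by (auto simp: vec_of_mat_def)

lemma dim_vec_of_mat [simp]: "dim_vec (vec_of_mat X) = dim_col X * dim_row X"
  by (simp add: vec_of_mat_def)

lemma index_vec_of_mat:
  "a < dim_col X * dim_row X \<Longrightarrow> vec_of_mat X $ a = X $$ (a mod dim_row X, a div dim_row X)"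
  by (simp add: vec_of_mat_def)

lemma vec_of_mat_surj:
  assumes "v \<in> carrier_vec (n * m)"
  shows "\<exists>X \<in> carrier_mat m n. v = vec_of_mat X"
proof (intro bexI)
  show "v = vec_of_mat (mat m n (\<lambda>(r, i). v $ (i * m + r)))"
    using assms by (intro eq_vecI) (auto simp: vec_of_mat_def div_mod_less)
qed simp

lemma vec_of_mat_inj:
  assumes X: "X \<in> carrier_mat m n" and Y: "Y \<in> carrier_mat m n" and eq: "vec_of_mat X = vec_of_mat Y"
  shows "X = Y"
proof (rule eq_matI)
  fix r i assume "r < dim_row Y" "i < dim_col Y"
  hence ri: "r < m" "i < n" using Y by auto
  hence *: "i * m + r < n * m"
    using ri by (intro block_index_less)
  hence "vec_of_mat X $ (i * m + r) = X $$ (r, i)" "vec_of_mat Y $ (i * m + r) = Y $$ (r, i)"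
    using ri X Y by (auto simp: index_vec_of_mat)
  with eq show "X $$ (r, i) = Y $$ (r, i)" by simp
qed (use X Y in auto)

lemma vec_of_mat_eq_0_iff:
  assumes "Y \<in> carrier_mat m n"
  shows "vec_of_mat Y = 0\<^sub>v (n * m) \<longleftrightarrow> Y = 0\<^sub>m m n"
proof -
  have "vec_of_mat (0\<^sub>m m n) = 0\<^sub>v (n * m)"
    by (intro eq_vecI) (auto simp: vec_of_mat_def div_mod_less)
  with vec_of_mat_inj[OF assms, of "0\<^sub>m m n"] show ?thesis by auto
qed

lemma smult_vec_of_mat: "c \<cdot>\<^sub>v vec_of_mat X = vec_of_mat (c \<cdot>\<^sub>m X)"
  by (rule eq_vecI) (auto simp: vec_of_mat_def div_mod_less)

text \<open>The left factor is block diagonal with \<open>n\<close> copies of \<open>V\<close>, so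
  it applies \<open>V\<close> to each column of \<open>Y\<close> separately.\<close>

lemma kronecker_one_mult_vec_of_mat:
  fixes V Y :: "complex mat"
  assumes V: "V \<in> carrier_mat m k" and Y: "Y \<in> carrier_mat k n"
  shows "kronecker (1\<^sub>m n) V *\<^sub>v vec_of_mat Y = vec_of_mat (V * Y)"
proof (rule eq_vecI)
  fix a assume "a < dim_vec (vec_of_mat (V * Y))"
  hence a: "a < n * m" using V Y by simp
  note am = div_mod_less[OF this]
  \<comment> \<open>The summand is displayed as a function of \<open>b div k\<close> and
    \<open>b mod k\<close> so that \<open>sum_div_mod\<close> applies.\<close>
  have "(kronecker (1\<^sub>m n) V *\<^sub>v vec_of_mat Y) $ a =
    (\<Sum>b<n * k. (\<lambda>i r. (if a div m = i then V $$ (a mod m, r) else 0) * Y $$ (r, i)) (b div k) (b mod k))"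
    using V Y a am
    by (auto simp: kronecker_def scalar_prod_def lessThan_atLeast0 index_vec_of_mat div_mod_less intro!: sum.cong)
  also have "\<dots> = (\<Sum>i<n. if i = a div m then \<Sum>r<k. V $$ (a mod m, r) * Y $$ (r, i) else 0)"
    by (subst sum_div_mod, intro sum.cong) auto
  also have "\<dots> = (\<Sum>r<k. V $$ (a mod m, r) * Y $$ (r, a div m))" using am by simp
  also have "\<dots> = vec_of_mat (V * Y) $ a"
    using V Y a am by (simp add: index_vec_of_mat index_mult_mat_sum del: index_mult_mat(1))
  finally show "(kronecker (1\<^sub>m n) V *\<^sub>v vec_of_mat Y) $ a = vec_of_mat (V * Y) $ a" .
qed (use V Y in \<open>auto simp: kronecker_def\<close>)

lemma adjoint_kronecker_one:
  fixes V :: "complex mat"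
  shows "mat_adjoint (kronecker (1\<^sub>m n) V) = kronecker (1\<^sub>m n) (mat_adjoint V)"
  by (rule eq_matI) (auto simp: kronecker_def div_mod_less)

lemma index_outer_self:
  "a < dim_vec z \<Longrightarrow> b < dim_vec z \<Longrightarrow> outer_self z $$ (a, b) = z $ a * cnj (z $ b)"
  by (simp add: outer_self_def mat_adjoint_def scalar_prod_def mat_of_cols_index mat_of_rows_index)

lemma dim_outer_self [simp]:
  "dim_row (outer_self z) = dim_vec z" "dim_col (outer_self z) = dim_vec z"
  by (auto simp: outer_self_def)

text \<open>Swapping blocks exchanges the two column indices of \<open>B\<close>: at block row
  \<open>j\<close>, position \<open>s\<close>, and block column \<open>i\<close>, position
  \<open>r\<close>, the entry becomes \<open>c * (B $$ (s, i) * cnj (B $$ (r, j)))\<close>. Summing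
  against \<open>X $$ (r, i)\<close> therefore contracts \<open>X\<close> through its
  transpose.\<close>

lemma partial_transpose_outer_self_mult:
  fixes B X :: "complex mat"
  assumes B: "B \<in> carrier_mat m n" and X: "X \<in> carrier_mat m n"
  shows "partial_transpose n m (c \<cdot>\<^sub>m outer_self (vec_of_mat B)) *\<^sub>v vec_of_mat X =
         vec_of_mat (c \<cdot>\<^sub>m (B * transpose_mat X * map_mat cnj B))"
proof (rule eq_vecI)
  fix a assume "a < dim_vec (vec_of_mat (c \<cdot>\<^sub>m (B * transpose_mat X * map_mat cnj B)))"
  hence a: "a < n * m" using B by simp
  note am = div_mod_less[OF this]
  have "(partial_transpose n m (c \<cdot>\<^sub>m outer_self (vec_of_mat B)) *\<^sub>v vec_of_mat X) $ a =
    (\<Sum>b<n * m. (\<lambda>i r. c * (B $$ (a mod m, i) * cnj (B $$ (r, a div m)) * X $$ (r, i))) (b div m) (b mod m))"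
    using B X a am
    by (auto simp: partial_transpose_def scalar_prod_def lessThan_atLeast0 index_vec_of_mat div_mod_less
       index_outer_self block_index_less block_div block_mod intro!: sum.cong)
  also have "\<dots> = c * (\<Sum>r<m. (\<Sum>i<n. B $$ (a mod m, i) * X $$ (r, i)) * cnj (B $$ (r, a div m)))"
    by (subst sum_div_mod, subst sum.swap) (simp add: sum_distrib_left sum_distrib_right mult_ac)
  also have "\<dots> = vec_of_mat (c \<cdot>\<^sub>m (B * transpose_mat X * map_mat cnj B)) $ a"
    using B X a am by (simp add: index_vec_of_mat index_mult_mat_sum del: index_mult_mat(1) assoc_mult_mat)
  finally show "(partial_transpose n m (c \<cdot>\<^sub>m outer_self (vec_of_mat B)) *\<^sub>v vec_of_mat X) $ a =
     vec_of_mat (c \<cdot>\<^sub>m (B * transpose_mat X * map_mat cnj B)) $ a" .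
qed (use B X in \<open>auto simp: partial_transpose_def\<close>)

section \<open>The eigenvalue equation on matrices and its unitary invariance\<close>

lemma map_mat_cnj_mult:
  assumes "dim_col A = dim_row B"
  shows "map_mat cnj (A * B) = map_mat cnj A * map_mat cnj B"
  by (rule eq_matI) (use assms in \<open>auto simp del: index_mult_mat(1) simp add: index_mult_mat_sum\<close>)

lemma transpose_map_mat_cnj: "transpose_mat (map_mat cnj A) = mat_adjoint A"
  by (rule eq_matI) auto

text \<open>An eigenvector of the compressed partial transpose is \<open>vec Y\<close> for a solution \<open>Y\<close> of this
  equation with \<open>C = V\<^sup>* B\<close>; the coefficient \<open>c\<close> carries the sign of \<open>\<gamma>\<^sup>\<plusminus>\<close>.\<close>

definition twisted_eigen :: "complex \<Rightarrow> complex mat \<Rightarrow> complex \<Rightarrow> bool" where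
  "twisted_eigen c C \<mu> \<longleftrightarrow> (\<exists>Y \<in> carrier_mat (dim_row C) (dim_col C).
     Y \<noteq> 0\<^sub>m (dim_row C) (dim_col C) \<and> c \<cdot>\<^sub>m (C * transpose_mat Y * map_mat cnj C) = \<mu> \<cdot>\<^sub>m Y)"

lemma compression_mult_vec_of_mat:
  fixes B V Y :: "complex mat"
  assumes B: "B \<in> carrier_mat m n" and V: "V \<in> carrier_mat m k" and Y: "Y \<in> carrier_mat k n"
  defines "K \<equiv> kronecker (1\<^sub>m n) V" and "C \<equiv> mat_adjoint V * B"
  shows "(mat_adjoint K * partial_transpose n m (c \<cdot>\<^sub>m outer_self (vec_of_mat B)) * K) *\<^sub>v vec_of_mat Y
         = vec_of_mat (c \<cdot>\<^sub>m (C * transpose_mat Y * map_mat cnj C))"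
proof -
  let ?T = "partial_transpose n m (c \<cdot>\<^sub>m outer_self (vec_of_mat B))"
  have K: "K \<in> carrier_mat (n * m) (n * k)" using V by (auto simp: K_def kronecker_def)
  have K': "mat_adjoint K \<in> carrier_mat (n * k) (n * m)" using K by auto
  have T: "?T \<in> carrier_mat (n * m) (n * m)" by (simp add: partial_transpose_def)
  have V': "mat_adjoint V \<in> carrier_mat k m" using V by auto
  have VY: "V * Y \<in> carrier_mat m n" using V Y by auto
  let ?D = "c \<cdot>\<^sub>m (B * transpose_mat (V * Y) * map_mat cnj B)"
  have D: "?D \<in> carrier_mat m n" using B VY by auto
  \<comment> \<open>The transpose of \<open>V * Y\<close> leaves \<open>transpose_mat V\<close> in
    front of \<open>map_mat cnj B\<close>; this product is the right-hand factor
    \<open>map_mat cnj C\<close>.\<close>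
  have cC: "map_mat cnj C = transpose_mat V * map_mat cnj B"
    unfolding C_def using V B
    by (subst map_mat_cnj_mult) (auto intro!: arg_cong2[of _ _ _ _ "(*)"] eq_matI)
  have "(mat_adjoint K * ?T * K) *\<^sub>v vec_of_mat Y = mat_adjoint K *\<^sub>v (?T *\<^sub>v (K *\<^sub>v vec_of_mat Y))"
    using K K' T vec_of_mat_carrier[OF Y]
    by (simp add: assoc_mult_mat_vec[of _ "n * k" "n * m" _ "n * k"] assoc_mult_mat_vec[of _ "n * k" "n * m" _ "n * m"]
       assoc_mult_mat_vec[of _ "n * m" "n * m" _ "n * k"] mult_mat_vec_carrier[OF K]
       assoc_mult_mat[of _ "n * k" "n * m" _ "n * m" _ "n * k"])
  also have "K *\<^sub>v vec_of_mat Y = vec_of_mat (V * Y)"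
    unfolding K_def by (rule kronecker_one_mult_vec_of_mat[OF V Y])
  also have "?T *\<^sub>v \<dots> = vec_of_mat ?D"
    by (rule partial_transpose_outer_self_mult[OF B VY])
  also have "mat_adjoint K *\<^sub>v \<dots> = vec_of_mat (mat_adjoint V * ?D)"
    unfolding K_def adjoint_kronecker_one by (rule kronecker_one_mult_vec_of_mat[OF V' D])
  also have "mat_adjoint V * ?D = c \<cdot>\<^sub>m (mat_adjoint V * (B * transpose_mat (V * Y) * map_mat cnj B))"
    using V' B VY by (intro mult_smult_distrib) auto
  also have "mat_adjoint V * (B * transpose_mat (V * Y) * map_mat cnj B) =
      C * transpose_mat Y * (transpose_mat V * map_mat cnj B)"
    unfolding C_def transpose_mult[OF V Y]
    using carrier_matD[OF V] carrier_matD[OF B] carrier_matD[OF Y] by (simp add: mult_mat_assoc_dim)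
  finally show ?thesis unfolding cC .
qed

text \<open>\<open>vec_of_mat\<close> is a linear bijection from \<open>k \<times> n\<close>
  matrices to vectors of length \<open>n * k\<close>, so eigenvectors correspond exactly to nonzero
  solutions \<open>Y\<close>.\<close>

lemma eigenvalue_compression_iff:
  fixes B V :: "complex mat"
  assumes B: "B \<in> carrier_mat m n" and V: "V \<in> carrier_mat m k"
  defines "K \<equiv> kronecker (1\<^sub>m n) V"
  shows "eigenvalue (mat_adjoint K * partial_transpose n m (c \<cdot>\<^sub>m outer_self (vec_of_mat B)) * K) \<mu>
         \<longleftrightarrow> twisted_eigen c (mat_adjoint V * B) \<mu>"
proof -
  let ?C = "mat_adjoint V * B"
  let ?H = "mat_adjoint K * partial_transpose n m (c \<cdot>\<^sub>m outer_self (vec_of_mat B)) * K"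
  have H: "dim_row ?H = n * k" using V by (simp add: K_def kronecker_def)
  have C: "dim_row ?C = k" "dim_col ?C = n" using B V by auto
  have "eigenvector ?H (vec_of_mat Y) \<mu> \<longleftrightarrow>
      Y \<noteq> 0\<^sub>m k n \<and> c \<cdot>\<^sub>m (?C * transpose_mat Y * map_mat cnj ?C) = \<mu> \<cdot>\<^sub>m Y"
    if Y: "Y \<in> carrier_mat k n" for Y
  proof -
    have c1: "c \<cdot>\<^sub>m (?C * transpose_mat Y * map_mat cnj ?C) \<in> carrier_mat k n"
      by (rule carrier_matI) (use C in simp_all)
    have c2: "\<mu> \<cdot>\<^sub>m Y \<in> carrier_mat k n" using Y by simp
    have "vec_of_mat (c \<cdot>\<^sub>m (?C * transpose_mat Y * map_mat cnj ?C)) = vec_of_mat (\<mu> \<cdot>\<^sub>m Y) \<longleftrightarrow>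
       c \<cdot>\<^sub>m (?C * transpose_mat Y * map_mat cnj ?C) = \<mu> \<cdot>\<^sub>m Y"
      by (rule iffI, erule vec_of_mat_inj[OF c1 c2], erule arg_cong)
    then show ?thesis
      unfolding eigenvector_def H compression_mult_vec_of_mat[OF B V Y, folded K_def] smult_vec_of_mat
        vec_of_mat_eq_0_iff[OF Y] using vec_of_mat_carrier[OF Y] by blast
  qed
  moreover have "\<exists>Y \<in> carrier_mat k n. v = vec_of_mat Y" if "eigenvector ?H v \<mu>" for v
    using that H by (intro vec_of_mat_surj) (auto simp: eigenvector_def)
  ultimately show ?thesis unfolding eigenvalue_def twisted_eigen_def C by blast
qed

text \<open>The new solution is \<open>Y * map_mat cnj U\<close>. Its transpose starts with
  \<open>mat_adjoint U\<close>, which cancels the \<open>U\<close> to its left; what remains is the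
  old equation multiplied by \<open>map_mat cnj U\<close> on the right.\<close>

lemma twisted_eigen_mult_unitary:
  assumes C: "C \<in> carrier_mat k n" and U: "U \<in> carrier_mat n n" "mat_adjoint U * U = 1\<^sub>m n"
    and "twisted_eigen c C \<mu>"
  shows "twisted_eigen c (C * U) \<mu>"
proof -
  obtain Y where Y: "Y \<in> carrier_mat k n" "Y \<noteq> 0\<^sub>m k n"
    "c \<cdot>\<^sub>m (C * transpose_mat Y * map_mat cnj C) = \<mu> \<cdot>\<^sub>m Y"
    using assms(4) C by (auto simp: twisted_eigen_def)
  have UU: "U * mat_adjoint U = 1\<^sub>m n" by (rule unitary_comm[OF U])
  have Uc: "map_mat cnj U \<in> carrier_mat n n" and Ut: "transpose_mat U \<in> carrier_mat n n"
    using U(1) by simp_all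
  have UcUt: "map_mat cnj U * transpose_mat U = 1\<^sub>m n"
  proof -
    have "map_mat cnj U * transpose_mat U = map_mat cnj (U * mat_adjoint U)"
      using U by (subst map_mat_cnj_mult) (auto intro!: arg_cong2[of _ _ _ _ "(*)"] eq_matI)
    also have "\<dots> = 1\<^sub>m n" unfolding UU by (auto intro!: eq_matI)
    finally show ?thesis .
  qed
  define Y' where "Y' = Y * map_mat cnj U"
  have Y': "Y' \<in> carrier_mat k n" using Y Uc by (simp add: Y'_def)
  have "Y = Y' * transpose_mat U"
    unfolding Y'_def using Y Uc Ut UcUt by (simp add: assoc_mult_mat[of _ k n _ n _ n])
  hence Y'0: "Y' \<noteq> 0\<^sub>m k n" using Y(2) Ut by auto
  have t: "transpose_mat Y' = mat_adjoint U * transpose_mat Y"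
    unfolding Y'_def transpose_mult[OF Y(1) Uc] transpose_map_mat_cnj ..
  have CYC: "C * transpose_mat Y * map_mat cnj C \<in> carrier_mat k n"
    by (rule carrier_matI) (use C in simp_all)
  have "C * U * transpose_mat Y' * map_mat cnj (C * U) =
    C * (U * mat_adjoint U) * transpose_mat Y * map_mat cnj C * map_mat cnj U"
    unfolding t using carrier_matD[OF C] carrier_matD[OF U(1)] carrier_matD[OF Y(1)]
    by (simp add: map_mat_cnj_mult mult_mat_assoc_dim)
  also have "\<dots> = (C * transpose_mat Y * map_mat cnj C) * map_mat cnj U" using C UU by simp
  finally have "c \<cdot>\<^sub>m (C * U * transpose_mat Y' * map_mat cnj (C * U)) =
     (c \<cdot>\<^sub>m (C * transpose_mat Y * map_mat cnj C)) * map_mat cnj U"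
    by (simp only: mult_smult_assoc_mat[OF CYC Uc])
  also have "\<dots> = \<mu> \<cdot>\<^sub>m Y'"
    unfolding Y(3) Y'_def using Y Uc by (simp add: mult_smult_assoc_mat[of _ k n _ n])
  finally show ?thesis using Y' Y'0 C U unfolding twisted_eigen_def by auto
qed

text \<open>The converse is the previous implication for \<open>C * U\<close> and the unitary matrix
  \<open>mat_adjoint U\<close>.\<close>

lemma twisted_eigen_mult_unitary_iff:
  assumes C: "C \<in> carrier_mat k n" and U: "U \<in> carrier_mat n n" "mat_adjoint U * U = 1\<^sub>m n"
  shows "twisted_eigen c (C * U) \<mu> \<longleftrightarrow> twisted_eigen c C \<mu>"
proof
  assume eig: "twisted_eigen c (C * U) \<mu>"
  have CU: "C * U \<in> carrier_mat k n" using C U by auto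
  have "C * U * mat_adjoint U = C * (U * mat_adjoint U)" using C U by (intro mult_mat_assoc_dim) auto
  also have "\<dots> = C" unfolding unitary_comm[OF U] using C by simp
  finally have "C * U * mat_adjoint U = C" .
  with twisted_eigen_mult_unitary[OF CU mat_adjoint_carrier[OF U(1)] _ eig] unitary_comm[OF U]
  show "twisted_eigen c C \<mu>" by (simp only: mat_adjoint_adjoint)
qed (rule twisted_eigen_mult_unitary[OF C U])

section \<open>The quadratic identity and upper bounds for eigenvalues\<close>

definition fro_sq :: "complex mat \<Rightarrow> real" where
  "fro_sq M = (\<Sum>a<dim_col M. \<Sum>r<dim_row M. (cmod (M $$ (r, a)))\<^sup>2)"

lemma fro_sq_pos:
  assumes "Y \<in> carrier_mat k n" "Y \<noteq> 0\<^sub>m k n"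
  shows "fro_sq Y > 0"
proof -
  obtain r a where ra: "r < k" "a < n" "Y $$ (r, a) \<noteq> 0"
    using assms by (metis carrier_matD eq_matI index_zero_mat)
  have "0 < (cmod (Y $$ (r, a)))\<^sup>2" using ra by simp
  also have "\<dots> \<le> (\<Sum>r<k. (cmod (Y $$ (r, a)))\<^sup>2)" using ra by (intro member_le_sum) auto
  also have "\<dots> \<le> (\<Sum>a<n. \<Sum>r<k. (cmod (Y $$ (r, a)))\<^sup>2)"
    using ra by (intro member_le_sum[of a "{..<n}" "\<lambda>a. \<Sum>r<k. (cmod (Y $$ (r, a)))\<^sup>2"] sum_nonneg) auto
  finally show ?thesis using assms by (simp add: fro_sq_def)
qed

text \<open>The Frobenius inner product of the equation with \<open>Y\<close>; the double sum is the
  trace of \<open>M * map_mat cnj M\<close>.\<close>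

lemma twisted_eigenvalue_identity:
  assumes F: "F \<in> carrier_mat k n" and Y: "Y \<in> carrier_mat k n"
    and eq: "c \<cdot>\<^sub>m (F * transpose_mat Y * map_mat cnj F) = \<mu> \<cdot>\<^sub>m Y"
  defines "M \<equiv> mat_adjoint Y * F"
  shows "\<mu> * of_real (fro_sq Y) = c * (\<Sum>a<n. \<Sum>b<n. M $$ (a, b) * cnj (M $$ (b, a)))"
proof -
  have Mc: "cnj (M $$ (a, b)) = (\<Sum>r<k. Y $$ (r, a) * cnj (F $$ (r, b)))" if "a < n" "b < n" for a b
    unfolding M_def using F Y that by (subst index_adjoint_mult) auto
  have M: "M $$ (a, b) = (\<Sum>r<k. cnj (Y $$ (r, a)) * F $$ (r, b))" if "a < n" "b < n" for a b
    unfolding M_def using F Y that by (subst index_adjoint_mult) auto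
  have eq': "c * (\<Sum>b<n. F $$ (r, b) * cnj (M $$ (b, a))) = \<mu> * Y $$ (r, a)" if "r < k" "a < n" for r a
  proof -
    have "(F * transpose_mat Y * map_mat cnj F) $$ (r, a) = (F * (transpose_mat Y * map_mat cnj F)) $$ (r, a)"
      using F Y by (subst assoc_mult_mat[of _ k n _ k _ n]) auto
    also have "\<dots> = (\<Sum>b<n. F $$ (r, b) * cnj (M $$ (b, a)))"
      using F Y that by (simp add: index_mult_mat_sum Mc del: index_mult_mat(1) assoc_mult_mat)
    finally show ?thesis
      using arg_cong[OF eq, of "\<lambda>A. A $$ (r, a)"] that F Y by simp
  qed
  have "\<mu> * of_real (fro_sq Y) = (\<Sum>a<n. \<Sum>r<k. cnj (Y $$ (r, a)) * (\<mu> * Y $$ (r, a)))"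
    unfolding fro_sq_def using Y
    by (simp add: sum_distrib_left complex_norm_square mult_ac del: of_real_power)
  also have "\<dots> = (\<Sum>a<n. \<Sum>r<k. cnj (Y $$ (r, a)) * (c * (\<Sum>b<n. F $$ (r, b) * cnj (M $$ (b, a)))))"
    by (intro sum.cong refl) (simp add: eq')
  also have "\<dots> = (\<Sum>a<n. c * (\<Sum>b<n. M $$ (a, b) * cnj (M $$ (b, a))))"
  proof (intro sum.cong refl)
    fix a assume "a \<in> {..<n}"
    hence a: "a < n" by simp
    have "(\<Sum>r<k. cnj (Y $$ (r, a)) * (c * (\<Sum>b<n. F $$ (r, b) * cnj (M $$ (b, a)))))
      = (\<Sum>r<k. \<Sum>b<n. c * (cnj (Y $$ (r, a)) * F $$ (r, b) * cnj (M $$ (b, a))))"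
      by (simp add: sum_distrib_left mult_ac)
    also have "\<dots> = c * (\<Sum>b<n. (\<Sum>r<k. cnj (Y $$ (r, a)) * F $$ (r, b)) * cnj (M $$ (b, a)))"
      by (subst sum.swap) (simp add: sum_distrib_left sum_distrib_right)
    also have "\<dots> = c * (\<Sum>b<n. M $$ (a, b) * cnj (M $$ (b, a)))"
      using a M[OF a] by simp
    finally show "(\<Sum>r<k. cnj (Y $$ (r, a)) * (c * (\<Sum>b<n. F $$ (r, b) * cnj (M $$ (b, a))))) =
      c * (\<Sum>b<n. M $$ (a, b) * cnj (M $$ (b, a)))" .
  qed
  finally show ?thesis by (simp add: sum_distrib_left)
qed

text \<open>Conjugating the double sum of the quadratic identity only swaps its two indices. This
  reality later makes the set of real eigenvalues in \<open>lambda_max\<close> nonempty.\<close>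

lemma twisted_eigen_real:
  assumes "twisted_eigen (of_real e) C \<mu>"
  shows "\<mu> \<in> \<real>"
proof -
  define k n where "k = dim_row C" and "n = dim_col C"
  have C: "C \<in> carrier_mat k n" by (auto simp: k_def n_def)
  obtain Y where Y: "Y \<in> carrier_mat k n" "Y \<noteq> 0\<^sub>m k n"
    "of_real e \<cdot>\<^sub>m (C * transpose_mat Y * map_mat cnj C) = \<mu> \<cdot>\<^sub>m Y"
    using assms by (auto simp: twisted_eigen_def k_def n_def)
  let ?M = "mat_adjoint Y * C"
  let ?S = "\<Sum>a<n. \<Sum>b<n. ?M $$ (a, b) * cnj (?M $$ (b, a))"
  have "cnj ?S = (\<Sum>a<n. \<Sum>b<n. ?M $$ (b, a) * cnj (?M $$ (a, b)))"
    by (simp add: mult.commute)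
  also have "\<dots> = ?S" by (rule sum.swap)
  finally have "?S \<in> \<real>" by (simp add: Reals_cnj_iff)
  have "\<mu> = of_real e * ?S / of_real (fro_sq Y)"
    using twisted_eigenvalue_identity[OF C Y(1,3)] fro_sq_pos[OF Y(1,2)] by (simp add: field_simps)
  with \<open>?S \<in> \<real>\<close> show ?thesis by simp
qed

lemma abs_Re_mult_cnj_le: "\<bar>Re (z * cnj w)\<bar> \<le> ((cmod z)\<^sup>2 + (cmod w)\<^sup>2) / 2"
proof -
  have "\<bar>Re (z * cnj w)\<bar> \<le> cmod z * cmod w" using abs_Re_le_cmod[of "z * cnj w"] by (simp add: norm_mult)
  also have "\<dots> \<le> ((cmod z)\<^sup>2 + (cmod w)\<^sup>2) / 2"
    using sum_squares_bound[of "cmod z" "cmod w"] by simp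
  finally show ?thesis .
qed

text \<open>One estimate for both signs \<open>e\<close>. Here \<open>F\<close> is \<open>G\<close>
  with column \<open>b\<close> scaled by \<open>s b\<close>, so the quadratic identity can be
  bounded one index pair at a time. The clause \<open>a = b \<Longrightarrow> z = w\<close> in
  \<open>le\<close> records that a diagonal entry is paired with itself, which fixes the sign of
  diagonal terms.\<close>

lemma twisted_eigen_le:
  fixes s :: "nat \<Rightarrow> real"
  assumes F: "F \<in> carrier_mat k n" and G: "G \<in> carrier_mat k n"
    and FG: "\<And>r b. r < k \<Longrightarrow> b < n \<Longrightarrow> F $$ (r, b) = of_real (s b) * G $$ (r, b)"
    and contr: "\<And>Y. Y \<in> carrier_mat k n \<Longrightarrow> fro_sq (mat_adjoint Y * G) \<le> fro_sq Y"
    and le: "\<And>a b z w. a < n \<Longrightarrow> b < n \<Longrightarrow> (a = b \<Longrightarrow> z = w) \<Longrightarrow>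
        e * (s a * s b) * Re (z * cnj w) \<le> K * ((cmod z)\<^sup>2 + (cmod w)\<^sup>2) / 2"
    and "K \<ge> 0"
    and eig: "twisted_eigen (of_real e) F (of_real \<mu>)"
  shows "\<mu> \<le> K"
proof -
  obtain Y where Y: "Y \<in> carrier_mat k n" "Y \<noteq> 0\<^sub>m k n"
    "of_real e \<cdot>\<^sub>m (F * transpose_mat Y * map_mat cnj F) = of_real \<mu> \<cdot>\<^sub>m Y"
    using eig F by (auto simp: twisted_eigen_def)
  define M Z where "M = mat_adjoint Y * F" and "Z = mat_adjoint Y * G"
  have Z: "Z \<in> carrier_mat n n" using Y G by (auto simp: Z_def)
  have sq: "(\<Sum>a<n. \<Sum>b<n. (cmod (Z $$ (b, a)))\<^sup>2) = fro_sq Z"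
    using Z by (simp add: fro_sq_def)
  have sq': "(\<Sum>a<n. \<Sum>b<n. (cmod (Z $$ (a, b)))\<^sup>2) = fro_sq Z"
    by (subst sum.swap) (rule sq)
  have MZ: "M $$ (a, b) = of_real (s b) * Z $$ (a, b)" if "a < n" "b < n" for a b
    unfolding M_def Z_def using F G Y that
    by (simp add: index_adjoint_mult FG sum_distrib_left mult_ac del: index_mult_mat(1))
  have "complex_of_real (\<mu> * fro_sq Y) = of_real e * (\<Sum>a<n. \<Sum>b<n. M $$ (a, b) * cnj (M $$ (b, a)))"
    unfolding M_def of_real_mult by (rule twisted_eigenvalue_identity[OF F Y(1,3)])
  hence "\<mu> * fro_sq Y = Re (of_real e * (\<Sum>a<n. \<Sum>b<n. M $$ (a, b) * cnj (M $$ (b, a))))"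
    by (metis Re_complex_of_real)
  also have "\<dots> = (\<Sum>a<n. \<Sum>b<n. Re (of_real e * (M $$ (a, b) * cnj (M $$ (b, a)))))"
    by (simp only: sum_distrib_left Re_sum)
  also have "\<dots> = (\<Sum>a<n. \<Sum>b<n. e * (s a * s b) * Re (Z $$ (a, b) * cnj (Z $$ (b, a))))"
    by (intro sum.cong refl) (auto simp: MZ algebra_simps)
  also have "\<dots> \<le> (\<Sum>a<n. \<Sum>b<n. K * ((cmod (Z $$ (a, b)))\<^sup>2 + (cmod (Z $$ (b, a)))\<^sup>2) / 2)"
    by (intro sum_mono le) auto
  also have "\<dots> = K * ((\<Sum>a<n. \<Sum>b<n. (cmod (Z $$ (a, b)))\<^sup>2) + (\<Sum>a<n. \<Sum>b<n. (cmod (Z $$ (b, a)))\<^sup>2)) / 2"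
    by (simp add: sum.distrib sum_distrib_left sum_divide_distrib add_divide_distrib distrib_left)
  also have "\<dots> = K * fro_sq Z"
    unfolding sq sq' by simp
  also have "\<dots> \<le> K * fro_sq Y" using contr[OF Y(1)] \<open>K \<ge> 0\<close> by (intro mult_left_mono) (auto simp: Z_def)
  finally show ?thesis using fro_sq_pos[OF Y(1,2)] by simp
qed

text \<open>With a single row, \<open>M $$ (a, b)\<close> is a product of a factor in
  \<open>a\<close> and a factor in \<open>b\<close>, so the double sum collapses to
  \<open>cnj t * t\<close>.\<close>

lemma twisted_eigen_row_nonpos:
  assumes C: "C \<in> carrier_mat 1 n" and eig: "twisted_eigen (- 1) C (of_real \<mu>)"
  shows "\<mu> \<le> 0"
proof -
  obtain Y where Y: "Y \<in> carrier_mat 1 n" "Y \<noteq> 0\<^sub>m 1 n"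
    "(- 1) \<cdot>\<^sub>m (C * transpose_mat Y * map_mat cnj C) = of_real \<mu> \<cdot>\<^sub>m Y"
    using eig C by (auto simp: twisted_eigen_def)
  define M where "M = mat_adjoint Y * C"
  define t where "t = (\<Sum>b<n. C $$ (0, b) * Y $$ (0, b))"
  have M: "M $$ (a, b) = cnj (Y $$ (0, a)) * C $$ (0, b)" if "a < n" "b < n" for a b
    unfolding M_def using C Y that by (simp add: index_adjoint_mult del: index_mult_mat(1))
  have "(\<Sum>a<n. \<Sum>b<n. M $$ (a, b) * cnj (M $$ (b, a))) =
      (\<Sum>a<n. \<Sum>b<n. cnj (C $$ (0, a) * Y $$ (0, a)) * (C $$ (0, b) * Y $$ (0, b)))"
    by (intro sum.cong refl) (auto simp: M mult_ac)
  also have "\<dots> = cnj t * t"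
    unfolding t_def cnj_sum by (rule sum_product[symmetric])
  also have "\<dots> = of_real ((cmod t)\<^sup>2)" by (simp add: complex_norm_square mult.commute del: of_real_power)
  finally have "complex_of_real (\<mu> * fro_sq Y) = of_real (- (cmod t)\<^sup>2)"
    using twisted_eigenvalue_identity[OF C Y(1,3)] by (simp add: M_def)
  hence "\<mu> * fro_sq Y \<le> 0" by (simp only: of_real_eq_iff) simp
  then show ?thesis using fro_sq_pos[OF Y(1,2)] by (simp add: mult_le_0_iff)
qed

subsection \<open>Bessel's inequality and extremal solutions\<close>

text \<open>The numbers \<open>d a\<close> allow zero vectors beside unit vectors, since left
  singular vectors for the singular value 0 are zero columns.\<close>

lemma Bessel_inequality:
  fixes x :: "nat \<Rightarrow> complex" and w :: "nat \<Rightarrow> nat \<Rightarrow> complex" and d :: "nat \<Rightarrow> real"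
  assumes orth: "\<And>a b. a < n \<Longrightarrow> b < n \<Longrightarrow>
      (\<Sum>r<m. cnj (w r a) * w r b) = (if a = b then of_real (d a) else 0)"
    and d: "\<And>a. a < n \<Longrightarrow> d a \<le> 1"
  shows "(\<Sum>b<n. (cmod (\<Sum>r<m. cnj (w r b) * x r))\<^sup>2) \<le> (\<Sum>r<m. (cmod (x r))\<^sup>2)"
proof -
  define c where "c b = (\<Sum>r<m. cnj (w r b) * x r)" for b
  \<comment> \<open>For orthonormal vectors this is the projection of \<open>x\<close> onto their
    span; the bound comes from expanding the squared norm of \<open>x - y\<close>.\<close>
  define y where "y r = (\<Sum>b<n. w r b * c b)" for r
  have "(\<Sum>r<m. cnj (y r) * x r) = (\<Sum>r<m. \<Sum>b<n. cnj (c b) * (cnj (w r b) * x r))"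
    by (simp add: y_def sum_distrib_left sum_distrib_right mult_ac)
  also have "\<dots> = (\<Sum>b<n. cnj (c b) * c b)"
    by (subst sum.swap) (simp add: sum_distrib_left c_def)
  finally have yx: "(\<Sum>r<m. cnj (y r) * x r) = of_real (\<Sum>b<n. (cmod (c b))\<^sup>2)"
    by (simp add: complex_norm_square mult.commute del: of_real_power)
  have "(\<Sum>r<m. cnj (y r) * y r) = (\<Sum>r<m. \<Sum>a<n. \<Sum>b<n. cnj (c a) * c b * (cnj (w r a) * w r b))"
    unfolding y_def cnj_sum sum_product by (intro sum.cong refl) simp
  also have "\<dots> = (\<Sum>a<n. \<Sum>b<n. \<Sum>r<m. cnj (c a) * c b * (cnj (w r a) * w r b))"
    by (subst sum.swap, intro sum.cong refl sum.swap)
  also have "\<dots> = (\<Sum>a<n. \<Sum>b<n. if a = b then cnj (c a) * c b * of_real (d a) else 0)"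
    by (intro sum.cong refl) (auto simp: orth simp flip: sum_distrib_left)
  also have "\<dots> = of_real (\<Sum>b<n. (cmod (c b))\<^sup>2 * d b)"
    by (simp add: complex_norm_square mult_ac del: of_real_power)
  finally have yy: "(\<Sum>r<m. cnj (y r) * y r) = of_real (\<Sum>b<n. (cmod (c b))\<^sup>2 * d b)" .
  have *: "(cmod (x r - y r))\<^sup>2 = (cmod (x r))\<^sup>2 + Re (cnj (y r) * y r) - 2 * Re (cnj (y r) * x r)" for r
    unfolding cmod_power2 by (simp add: power2_eq_square algebra_simps)
  have "0 \<le> (\<Sum>r<m. (cmod (x r - y r))\<^sup>2)" by (intro sum_nonneg) auto
  also have "\<dots> = (\<Sum>r<m. (cmod (x r))\<^sup>2) + Re (\<Sum>r<m. cnj (y r) * y r) - 2 * Re (\<Sum>r<m. cnj (y r) * x r)"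
    unfolding * Re_sum sum.distrib sum_subtractf sum_distrib_left ..
  also have "\<dots> = (\<Sum>r<m. (cmod (x r))\<^sup>2) + (\<Sum>b<n. (cmod (c b))\<^sup>2 * d b) - 2 * (\<Sum>b<n. (cmod (c b))\<^sup>2)"
    unfolding yx yy Re_complex_of_real ..
  finally have "0 \<le> \<dots>" .
  moreover have "(\<Sum>b<n. (cmod (c b))\<^sup>2 * d b) \<le> (\<Sum>b<n. (cmod (c b))\<^sup>2)"
    by (intro sum_mono mult_left_le) (use d in auto)
  ultimately show ?thesis unfolding c_def by linarith
qed

text \<open>Both sides are the trace of the same Gram matrix.\<close>

lemma fro_sq_isometry_mult:
  assumes V: "V \<in> carrier_mat m k" "mat_adjoint V * V = 1\<^sub>m k" and Y: "Y \<in> carrier_mat k n"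
  shows "fro_sq (V * Y) = fro_sq Y"
proof -
  have sq: "of_real (fro_sq X) = (\<Sum>a<n. (mat_adjoint X * X) $$ (a, a))" if "X \<in> carrier_mat p n" for X p
    using that by (simp add: fro_sq_def index_adjoint_mult complex_norm_square mult.commute
      del: of_real_power index_mult_mat(1))
  have "mat_adjoint (V * Y) * (V * Y) = mat_adjoint Y * (mat_adjoint V * V) * Y"
    using carrier_matD[OF V(1)] carrier_matD[OF Y] by (simp add: mat_adjoint_mult mult_mat_assoc_dim)
  also have "\<dots> = mat_adjoint Y * Y"
    unfolding V(2) using right_mult_one_mat[OF mat_adjoint_carrier[OF Y]] by simp
  finally have "complex_of_real (fro_sq (V * Y)) = of_real (fro_sq Y)"
    using sq[of "V * Y" m] sq[OF Y] V Y by auto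
  then show ?thesis by simp
qed

section \<open>Explicit solutions for the extremal values\<close>

lemma index_twisted:
  assumes F: "F \<in> carrier_mat k n" and Y: "Y \<in> carrier_mat k n" and "r < k" "j < n"
  shows "(F * transpose_mat Y * map_mat cnj F) $$ (r, j) =
    (\<Sum>l<k. (\<Sum>i<n. F $$ (r, i) * Y $$ (l, i)) * cnj (F $$ (l, j)))"
  using assms by (simp add: index_mult_mat_sum del: index_mult_mat(1) assoc_mult_mat)

text \<open>\<open>Y\<close> is the matrix unit at \<open>(0, b)\<close>: then
  \<open>F * transpose_mat Y\<close> contains only column \<open>b\<close> of \<open>F\<close> and
  zeros.\<close>

lemma twisted_eigen_zero_col:
  assumes F: "F \<in> carrier_mat k n" and "b < n" "0 < k" and z: "\<And>r. r < k \<Longrightarrow> F $$ (r, b) = 0"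
  shows "twisted_eigen c F 0"
proof -
  define Y :: "complex mat" where "Y = mat k n (\<lambda>(r, i). if i = b then if r = 0 then 1 else 0 else 0)"
  have Y: "Y \<in> carrier_mat k n" by (simp add: Y_def)
  have "Y $$ (0, b) \<noteq> 0\<^sub>m k n $$ (0, b)" using assms by (simp add: Y_def)
  hence "Y \<noteq> 0\<^sub>m k n" by auto
  moreover have "c \<cdot>\<^sub>m (F * transpose_mat Y * map_mat cnj F) = 0 \<cdot>\<^sub>m Y"
  proof (rule eq_matI)
    fix r j assume "r < dim_row (0 \<cdot>\<^sub>m Y)" "j < dim_col (0 \<cdot>\<^sub>m Y)"
    hence rj: "r < k" "j < n" using Y by auto
    have "(\<Sum>i<n. F $$ (r, i) * Y $$ (l, i)) = 0" if "l < k" for l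
      using that by (intro sum.neutral) (auto simp: Y_def z rj)
    then show "(c \<cdot>\<^sub>m (F * transpose_mat Y * map_mat cnj F)) $$ (r, j) = (0 \<cdot>\<^sub>m Y) $$ (r, j)"
      using index_twisted[OF F Y rj] F Y rj by (simp del: index_mult_mat(1) assoc_mult_mat)
  qed (use F Y in auto)
  ultimately show ?thesis using F Y unfolding twisted_eigen_def by auto
qed

text \<open>With \<open>Y\<close> the matrix unit at \<open>(0, 0)\<close>, the product is column 0
  of \<open>F\<close> times its conjugated row 0, and both are \<open>x\<close> times a unit
  vector.\<close>

lemma twisted_eigen_square:
  fixes x :: real
  assumes F: "F \<in> carrier_mat k n" and "0 < n" "0 < k"
    and col: "\<And>r. r < k \<Longrightarrow> F $$ (r, 0) = (if r = 0 then of_real x else 0)"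
    and row: "\<And>j. j < n \<Longrightarrow> F $$ (0, j) = (if j = 0 then of_real x else 0)"
  shows "twisted_eigen 1 F (of_real (x\<^sup>2))"
proof -
  define Y :: "complex mat" where "Y = mat k n (\<lambda>(r, i). if i = 0 then if r = 0 then 1 else 0 else 0)"
  have Y: "Y \<in> carrier_mat k n" by (simp add: Y_def)
  have "Y $$ (0, 0) \<noteq> 0\<^sub>m k n $$ (0, 0)" using assms(2,3) by (simp add: Y_def)
  hence "Y \<noteq> 0\<^sub>m k n" by auto
  moreover have "1 \<cdot>\<^sub>m (F * transpose_mat Y * map_mat cnj F) = of_real (x\<^sup>2) \<cdot>\<^sub>m Y"
  proof (rule eq_matI)
    fix r j assume "r < dim_row (of_real (x\<^sup>2) \<cdot>\<^sub>m Y)" "j < dim_col (of_real (x\<^sup>2) \<cdot>\<^sub>m Y)"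
    hence rj: "r < k" "j < n" using Y by auto
    have "(\<Sum>i<n. F $$ (r, i) * Y $$ (l, i)) = (if l = 0 then F $$ (r, 0) else 0)" if "l < k" for l
    proof -
      have "(\<Sum>i<n. F $$ (r, i) * Y $$ (l, i)) = (\<Sum>i<n. if i = 0 then if l = 0 then F $$ (r, i) else 0 else 0)"
        using that by (intro sum.cong) (auto simp: Y_def)
      also have "\<dots> = (if l = 0 then F $$ (r, 0) else 0)" using \<open>0 < n\<close> by simp
      finally show ?thesis .
    qed
    hence "(F * transpose_mat Y * map_mat cnj F) $$ (r, j) = (\<Sum>l<k. if l = 0 then F $$ (r, l) * cnj (F $$ (l, j)) else 0)"
      unfolding index_twisted[OF F Y rj] by (intro sum.cong) auto
    also have "\<dots> = F $$ (r, 0) * cnj (F $$ (0, j))" using \<open>0 < k\<close> by simp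
    also have "\<dots> = of_real (x\<^sup>2) * Y $$ (r, j)" using rj by (auto simp: col row Y_def power2_eq_square)
    finally show "(1 \<cdot>\<^sub>m (F * transpose_mat Y * map_mat cnj F)) $$ (r, j) = (of_real (x\<^sup>2) \<cdot>\<^sub>m Y) $$ (r, j)"
      using F Y rj by (simp del: index_mult_mat(1) assoc_mult_mat)
  qed (use F Y in auto)
  ultimately show ?thesis using F Y unfolding twisted_eigen_def by auto
qed

text \<open>\<open>Y\<close> is the antisymmetric combination of the matrix units at
  \<open>(0, 1)\<close> and \<open>(1, 0)\<close>. The product is column 1 times conjugated row 0
  minus column 0 times conjugated row 1, that is \<open>- (x * y)\<close> times \<open>Y\<close>;
  the coefficient \<open>- 1\<close> restores the sign.\<close>

lemma twisted_eigen_product: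
  fixes x y :: real
  assumes F: "F \<in> carrier_mat k n" and "1 < n" "1 < k"
    and col: "\<And>r. r < k \<Longrightarrow> F $$ (r, 0) = (if r = 0 then of_real x else 0)"
             "\<And>r. r < k \<Longrightarrow> F $$ (r, 1) = (if r = 1 then of_real y else 0)"
    and row: "\<And>j. j < n \<Longrightarrow> F $$ (0, j) = (if j = 0 then of_real x else 0)"
             "\<And>j. j < n \<Longrightarrow> F $$ (1, j) = (if j = 1 then of_real y else 0)"
  shows "twisted_eigen (- 1) F (of_real (x * y))"
proof -
  define Y :: "complex mat" where
    "Y = mat k n (\<lambda>(r, i). if r = 0 \<and> i = 1 then 1 else if r = 1 \<and> i = 0 then - 1 else 0)"
  have Y: "Y \<in> carrier_mat k n" by (simp add: Y_def)
  have "Y $$ (0, 1) \<noteq> 0\<^sub>m k n $$ (0, 1)" using assms(2,3) by (simp add: Y_def)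
  hence "Y \<noteq> 0\<^sub>m k n" by auto
  moreover have "(- 1) \<cdot>\<^sub>m (F * transpose_mat Y * map_mat cnj F) = of_real (x * y) \<cdot>\<^sub>m Y"
  proof (rule eq_matI)
    fix r j assume "r < dim_row (of_real (x * y) \<cdot>\<^sub>m Y)" "j < dim_col (of_real (x * y) \<cdot>\<^sub>m Y)"
    hence rj: "r < k" "j < n" using Y by auto
    have "(\<Sum>i<n. F $$ (r, i) * Y $$ (l, i)) = (if l = 0 then F $$ (r, 1) else if l = 1 then - F $$ (r, 0) else 0)"
      if "l < k" for l
    proof -
      \<comment> \<open>The summand is split into two pieces, each supported at a single index, so
        that both sums collapse.\<close>
      have "(\<Sum>i<n. F $$ (r, i) * Y $$ (l, i)) =
          (\<Sum>i<n. (if i = 1 then if l = 0 then F $$ (r, i) else 0 else 0) + (if i = 0 then if l = 1 then - F $$ (r, i) else 0 else 0))"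
        using that by (intro sum.cong) (auto simp: Y_def)
      also have "\<dots> = (if l = 0 then F $$ (r, 1) else if l = 1 then - F $$ (r, 0) else 0)"
        using \<open>1 < n\<close> unfolding sum.distrib by simp
      finally show ?thesis .
    qed
    hence "(F * transpose_mat Y * map_mat cnj F) $$ (r, j) =
       (\<Sum>l<k. (if l = 0 then F $$ (r, 1) * cnj (F $$ (l, j)) else 0) + (if l = 1 then - F $$ (r, 0) * cnj (F $$ (l, j)) else 0))"
      unfolding index_twisted[OF F Y rj] by (intro sum.cong) auto
    also have "\<dots> = F $$ (r, 1) * cnj (F $$ (0, j)) - F $$ (r, 0) * cnj (F $$ (1, j))"
      using \<open>1 < k\<close> unfolding sum.distrib by simp
    also have "\<dots> = - (of_real (x * y) * Y $$ (r, j))"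
      unfolding col[OF rj(1)] row[OF rj(2)] using rj by (auto simp: Y_def)
    finally show "((- 1) \<cdot>\<^sub>m (F * transpose_mat Y * map_mat cnj F)) $$ (r, j) = (of_real (x * y) \<cdot>\<^sub>m Y) $$ (r, j)"
      using F Y rj by (simp del: index_mult_mat(1) assoc_mult_mat)
  qed (use F Y in auto)
  ultimately show ?thesis using F Y unfolding twisted_eigen_def by auto
qed

text \<open>A nonzero column spans all others: a different column independent of it would give rank
  at least 2. A zero matrix factors trivially.\<close>

lemma (in vec_space) rank_le_1_factorization:
  assumes A: "A \<in> carrier_mat n nc" and "rank A \<le> 1"
  shows "\<exists>f g. \<forall>r<n. \<forall>j<nc. A $$ (r, j) = f r * g j"
proof (cases "\<exists>j<nc. col A j \<noteq> 0\<^sub>v n")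
  case False
  have "A $$ (r, j) = 0" if "r < n" "j < nc" for r j
  proof -
    have "col A j $ r = 0\<^sub>v n $ r" using False that by simp
    then show ?thesis using A that by simp
  qed
  then show ?thesis by (intro exI[of _ "\<lambda>_. 0"]) auto
next
  case True
  then obtain j0 where j0: "j0 < nc" "col A j0 \<noteq> 0\<^sub>v n" by auto
  let ?x = "col A j0"
  have x: "?x \<in> carrier_vec n" using A j0 by auto
  have "\<exists>c. \<forall>r<n. A $$ (r, j) = ?x $ r * c" if j: "j < nc" for j
  \<comment> \<open>Equal columns are treated apart, because the rank argument counts the two
    elements of \<open>{?x, ?y}\<close>.\<close>
  proof (cases "col A j = ?x")
    case True
    have "A $$ (r, j) = ?x $ r * 1" if "r < n" for r
      using A that j unfolding True[symmetric] by simp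
    then show ?thesis by blast
  next
    case False
    let ?y = "col A j"
    have y: "?y \<in> carrier_vec n" using A j by auto
    define M where "M = mat_of_cols n [?x, ?y]"
    have M: "M \<in> carrier_mat n 2" by (intro carrier_matI) (simp_all add: M_def)
    have cols: "cols M = [?x, ?y]" unfolding M_def using x y by simp
    have sub: "{?x, ?y} \<subseteq> set (cols A)" using A j j0 by (auto simp: cols_def)
    have "lin_dep (set (cols M))"
    proof (rule ccontr)
      assume "lin_indpt (set (cols M))"
      hence "card {?x, ?y} \<le> rank A"
        using rank_ge_card_indpt[OF A sub] by (simp add: cols)
      then show False using assms(2) False by simp
    qed
    from lin_depE[OF M this] False obtain v where v: "v \<in> carrier_vec 2" "v \<noteq> 0\<^sub>v 2" "M *\<^sub>v v = 0\<^sub>v n"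
      by (auto simp: cols)
    have eq: "?x $ r * v $ 0 + A $$ (r, j) * v $ 1 = 0" if "r < n" for r
      using arg_cong[OF v(3), of "\<lambda>w. w $ r"] that v(1) M A j
      by (auto simp: scalar_prod_def M_def mat_of_cols_index numeral_2_eq_2)
    \<comment> \<open>Otherwise the dependence would involve only the nonzero column
      \<open>?x\<close>.\<close>
    have v1: "v $ 1 \<noteq> 0"
    proof
      assume v1: "v $ 1 = 0"
      have "v $ 0 \<noteq> 0"
      proof
        assume "v $ 0 = 0"
        hence "v = 0\<^sub>v 2" using v1 v(1) by (intro eq_vecI) (auto simp: less_2_cases_iff)
        then show False using v by simp
      qed
      hence "?x = 0\<^sub>v n" using eq A v1 by (intro eq_vecI) auto
      then show False using j0 by simp
    qed
    have "A $$ (r, j) = ?x $ r * (- (v $ 0 / v $ 1))" if "r < n" for r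
      using eq[OF that] v1 by (simp add: field_simps eq_neg_iff_add_eq_0 add.commute)
    then show ?thesis by blast
  qed
  then obtain g where "\<forall>j<nc. \<forall>r<n. A $$ (r, j) = ?x $ r * g j" by metis
  then show ?thesis by (intro exI[of _ "\<lambda>r. ?x $ r"] exI[of _ g]) auto
qed

subsection \<open>Singular value decomposition and the extremal values\<close>

lemma proots_linear_factors: "proots (\<Prod>a\<leftarrow>as. [:- a, 1:]) = mset (as :: complex list)"
proof (induction as)
  case (Cons a as)
  have "(\<Prod>a\<leftarrow>as. [:- a, 1:]) \<noteq> 0" by (auto simp: prod_list_zero_iff)
  then show ?case using Cons by (simp add: proots_mult del: mult_pCons_left)
qed simp

text \<open>The columns of \<open>U\<close> are the right singular vectors of \<open>B\<close>, those of \<open>W\<close> the left ones, with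
  zero columns for the singular value 0. Indices are 0-based.\<close>

locale singular_decomposition =
  fixes m n :: nat and B U W :: "complex mat" and s :: "nat \<Rightarrow> real"
  assumes B: "B \<in> carrier_mat m n"
    and U: "U \<in> carrier_mat n n" "mat_adjoint U * U = 1\<^sub>m n"
    and W: "W \<in> carrier_mat m n"
    and BU: "\<And>r b. r < m \<Longrightarrow> b < n \<Longrightarrow> (B * U) $$ (r, b) = of_real (s b) * W $$ (r, b)"
    and WW: "\<And>a b. a < n \<Longrightarrow> b < n \<Longrightarrow>
      (\<Sum>r<m. cnj (W $$ (r, a)) * W $$ (r, b)) = (if a = b \<and> s a \<noteq> 0 then 1 else 0)"
    and s_nonneg: "\<And>b. b < n \<Longrightarrow> 0 \<le> s b"
    and s_decreasing: "\<And>a b. a \<le> b \<Longrightarrow> b < n \<Longrightarrow> s b \<le> s a"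

text \<open>Diagonalising \<open>mat_adjoint B * B\<close> by \<open>U\<close> makes the columns of
  \<open>B * U\<close> orthogonal, with the eigenvalues as squared norms; dividing by these norms
  gives \<open>W\<close>.\<close>

lemma singular_decomposition_exists:
  fixes B :: "complex mat"
  assumes B: "B \<in> carrier_mat m n"
  shows "\<exists>U W s. singular_decomposition m n B U W s \<and> (\<forall>i. i < m \<longrightarrow> i < n \<longrightarrow> singular_value B (Suc i) = s i)"
proof -
  define A where "A = mat_adjoint B * B"
  have A: "A \<in> carrier_mat n n" using B by (auto simp: A_def)
  have Aadj: "mat_adjoint A = A" using B by (simp add: A_def mat_adjoint_mult)
  obtain as where as: "char_poly A = (\<Prod>a\<leftarrow>as. [:- a, 1:])" "length as = n"
    using char_poly_factorized[OF A] by auto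
  define f where "f = (\<lambda>x :: complex. sqrt (Re x))"
  \<comment> \<open>Sorting uses the same key as \<open>singular_values\<close>. That the
    eigenvalues are real and nonnegative follows only afterwards, from the squared column norms in
    \<open>es_sum\<close>.\<close>
  define es where "es = rev (sort_key f as)"
  have mset: "mset es = mset as" by (simp add: es_def)
  have len: "length es = n" using as by (simp add: es_def)
  have "char_poly A = (\<Prod>e\<leftarrow>es. [:- e, 1:])"
    unfolding as prod_mset_prod_list[symmetric] mset_map mset ..
  from Hermitian_unitary_diagonalization[OF A Aadj this] obtain U where
    U: "U \<in> carrier_mat n n" "mat_adjoint U * U = 1\<^sub>m n"
       "mat_adjoint U * A * U = mat n n (\<lambda>(i, j). if i = j then es ! i else 0)" by auto
  have BUc: "B * U \<in> carrier_mat m n" using B U by auto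
  have "mat_adjoint (B * U) * (B * U) = mat_adjoint U * A * U"
    using carrier_matD[OF B] carrier_matD[OF U(1)] by (simp add: A_def mat_adjoint_mult mult_mat_assoc_dim)
  hence gram: "(\<Sum>r<m. cnj ((B * U) $$ (r, a)) * (B * U) $$ (r, b)) = (if a = b then es ! a else 0)"
    if "a < n" "b < n" for a b
    using index_adjoint_mult[of a "B * U" b "B * U"] carrier_matD[OF BUc] U(3) that
    by (simp del: index_mult_mat(1))
  define s where "s b = f (es ! b)" for b
  have es_sum: "es ! b = of_real (\<Sum>r<m. (cmod ((B * U) $$ (r, b)))\<^sup>2)" if "b < n" for b
    using gram[OF that that] by (simp add: complex_norm_square mult.commute del: of_real_power index_mult_mat(1))
  have s_sq: "(s b)\<^sup>2 = (\<Sum>r<m. (cmod ((B * U) $$ (r, b)))\<^sup>2)" if "b < n" for b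
    unfolding s_def f_def es_sum[OF that] by (simp add: sum_nonneg del: index_mult_mat(1))
  have es_sq: "es ! b = of_real ((s b)\<^sup>2)" if "b < n" for b
    unfolding s_sq[OF that] by (rule es_sum[OF that])
  \<comment> \<open>Division by 0 yields 0, which produces the zero columns for the singular value
    0.\<close>
  define W where "W = mat m n (\<lambda>(r, b). (B * U) $$ (r, b) / of_real (s b))"
  have "singular_decomposition m n B U W s"
  proof
    show "W \<in> carrier_mat m n" by (simp add: W_def)
    show "(B * U) $$ (r, b) = of_real (s b) * W $$ (r, b)" if rb: "r < m" "b < n" for r b
    proof (cases "s b = 0")
      case True
      hence "(\<Sum>r<m. (cmod ((B * U) $$ (r, b)))\<^sup>2) = 0" using s_sq[OF rb(2)] by simp
      hence "(cmod ((B * U) $$ (r, b)))\<^sup>2 = 0" using rb by (subst (asm) sum_nonneg_eq_0_iff) auto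
      then show ?thesis using True by (simp del: index_mult_mat(1))
    qed (use rb in \<open>simp add: W_def\<close>)
    show "(\<Sum>r<m. cnj (W $$ (r, a)) * W $$ (r, b)) = (if a = b \<and> s a \<noteq> 0 then 1 else 0)"
      if ab: "a < n" "b < n" for a b
    proof -
      have "(\<Sum>r<m. cnj (W $$ (r, a)) * W $$ (r, b)) =
          (\<Sum>r<m. cnj ((B * U) $$ (r, a)) * (B * U) $$ (r, b)) / (of_real (s a) * of_real (s b))"
        using ab by (simp add: W_def sum_divide_distrib del: index_mult_mat(1))
      also have "\<dots> = (if a = b \<and> s a \<noteq> 0 then 1 else 0)"
        unfolding gram[OF ab] using ab by (auto simp: es_sq power2_eq_square)
      finally show ?thesis .
    qed
    show "0 \<le> s b" if "b < n" for b
      unfolding s_def f_def es_sum[OF that] by (simp add: sum_nonneg del: index_mult_mat(1))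
    have "sorted (rev (map f es))" by (simp add: es_def rev_map[symmetric])
    then show "s b \<le> s a" if "a \<le> b" "b < n" for a b
      using that len sorted_rev_nth_mono[of "map f es" a b] by (simp add: s_def)
  qed (fact B U(1,2))+
  \<comment> \<open>\<open>s\<close> lists all \<open>n\<close> roots, while
    \<open>singular_values\<close> keeps the first \<open>min m n\<close>; hence both bounds on
    \<open>i\<close>.\<close>
  moreover have "singular_value B (Suc i) = s i" if "i < m" "i < n" for i
  proof -
    have "image_mset (\<lambda>x. sqrt (Re x)) (proots (char_poly (mat_adjoint B * B))) = mset (map f as)"
      unfolding A_def[symmetric] as(1) proots_linear_factors by (simp add: f_def)
    hence "singular_values B = take (min m n) (rev (sort (map f as)))"
      unfolding singular_values_def using B by (simp only: sorted_list_of_multiset_mset) simp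
    also have "sort (map f as) = map f (sort_key f as)"
      by (rule properties_for_sort) auto
    also have "rev \<dots> = map f es" by (simp add: es_def rev_map)
    finally show ?thesis using that len by (simp add: singular_value_def s_def)
  qed
  ultimately show ?thesis by blast
qed

section \<open>Upper bounds and adapted isometries in terms of singular values\<close>

context singular_decomposition
begin

lemma index_compressed:
  assumes V: "V \<in> carrier_mat m k" and "r < k" "b < n"
  shows "(mat_adjoint V * B * U) $$ (r, b) = of_real (s b) * (mat_adjoint V * W) $$ (r, b)"
proof -
  have "mat_adjoint V * B * U = mat_adjoint V * (B * U)"
    using B U V by (intro mult_mat_assoc_dim) auto
  then show ?thesis using B U W V assms(2,3)
    by (simp add: index_adjoint_mult BU sum_distrib_left mult_ac del: index_mult_mat(1))
qed

text \<open>Up to conjugation, row \<open>a\<close> of the product holds the coefficients of column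
  \<open>a\<close> of \<open>V * Y\<close> against the columns of \<open>W\<close>. Bessel bounds
  each row, and \<open>V\<close> preserves the norm of \<open>Y\<close>.\<close>

lemma compressed_contraction:
  assumes V: "V \<in> carrier_mat m k" "mat_adjoint V * V = 1\<^sub>m k" and Y: "Y \<in> carrier_mat k n"
  shows "fro_sq (mat_adjoint Y * (mat_adjoint V * W)) \<le> fro_sq Y"
proof -
  define X where "X = V * Y"
  have X: "X \<in> carrier_mat m n" using V Y by (simp add: X_def)
  have "mat_adjoint Y * (mat_adjoint V * W) = mat_adjoint X * W"
    unfolding X_def using carrier_matD[OF V(1)] carrier_matD[OF Y] carrier_matD[OF W]
    by (simp add: mat_adjoint_mult mult_mat_assoc_dim)
  hence "fro_sq (mat_adjoint Y * (mat_adjoint V * W)) = (\<Sum>b<n. \<Sum>a<n. (cmod ((mat_adjoint X * W) $$ (a, b)))\<^sup>2)"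
    using X W by (simp add: fro_sq_def del: index_mult_mat(1))
  also have "\<dots> = (\<Sum>a<n. \<Sum>b<n. (cmod ((mat_adjoint X * W) $$ (a, b)))\<^sup>2)"
    by (rule sum.swap)
  also have "\<dots> \<le> (\<Sum>a<n. \<Sum>r<m. (cmod (X $$ (r, a)))\<^sup>2)"
  proof (rule sum_mono)
    fix a assume "a \<in> {..<n}"
    hence a: "a < n" by simp
    have "cmod ((mat_adjoint X * W) $$ (a, b)) = cmod (\<Sum>r<m. cnj (W $$ (r, b)) * X $$ (r, a))" if "b < n" for b
    proof -
      have "(mat_adjoint X * W) $$ (a, b) = cnj (\<Sum>r<m. cnj (W $$ (r, b)) * X $$ (r, a))"
        using X W a that by (simp add: index_adjoint_mult mult.commute del: index_mult_mat(1))
      then show ?thesis by (simp only: complex_mod_cnj)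
    qed
    hence "(\<Sum>b<n. (cmod ((mat_adjoint X * W) $$ (a, b)))\<^sup>2) =
        (\<Sum>b<n. (cmod (\<Sum>r<m. cnj (W $$ (r, b)) * X $$ (r, a)))\<^sup>2)" by simp
    also have "\<dots> \<le> (\<Sum>r<m. (cmod (X $$ (r, a)))\<^sup>2)"
      by (rule Bessel_inequality[where d = "\<lambda>b. if s b \<noteq> 0 then 1 else 0"]) (auto simp: WW)
    finally show "(\<Sum>b<n. (cmod ((mat_adjoint X * W) $$ (a, b)))\<^sup>2) \<le> (\<Sum>r<m. (cmod (X $$ (r, a)))\<^sup>2)" .
  qed
  also have "\<dots> = fro_sq X" using X by (simp add: fro_sq_def)
  also have "\<dots> = fro_sq Y" unfolding X_def by (rule fro_sq_isometry_mult[OF V Y])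
  finally show ?thesis .
qed

lemma compressed_eigen_le:
  assumes V: "V \<in> carrier_mat m k" "mat_adjoint V * V = 1\<^sub>m k"
    and le: "\<And>a b z w. a < n \<Longrightarrow> b < n \<Longrightarrow> (a = b \<Longrightarrow> z = w) \<Longrightarrow>
        e * (s a * s b) * Re (z * cnj w) \<le> K * ((cmod z)\<^sup>2 + (cmod w)\<^sup>2) / 2"
    and "K \<ge> 0"
    and eig: "twisted_eigen (of_real e) (mat_adjoint V * B) (of_real \<mu>)"
  shows "\<mu> \<le> K"
proof (rule twisted_eigen_le)
  have C: "mat_adjoint V * B \<in> carrier_mat k n" using V B by auto
  show "mat_adjoint V * B * U \<in> carrier_mat k n" using C U by auto
  show "twisted_eigen (of_real e) (mat_adjoint V * B * U) (of_real \<mu>)"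
    by (rule twisted_eigen_mult_unitary[OF C U eig])
  show "mat_adjoint V * W \<in> carrier_mat k n" using V W by auto
qed (use index_compressed[OF V(1)] compressed_contraction[OF V] le \<open>K \<ge> 0\<close> in auto)

lemma compressed_eigen_le_square:
  assumes V: "V \<in> carrier_mat m k" "mat_adjoint V * V = 1\<^sub>m k" and "0 < n"
    and eig: "twisted_eigen 1 (mat_adjoint V * B) (of_real \<mu>)"
  shows "\<mu> \<le> (s 0)\<^sup>2"
proof (rule compressed_eigen_le[OF V, of 1])
  fix a b :: nat and z w :: complex assume ab: "a < n" "b < n"
  have "s a * s b * Re (z * cnj w) \<le> s a * s b * (((cmod z)\<^sup>2 + (cmod w)\<^sup>2) / 2)"
    using ab abs_le_D1[OF abs_Re_mult_cnj_le] by (intro mult_left_mono mult_nonneg_nonneg s_nonneg)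
  also have "\<dots> \<le> (s 0)\<^sup>2 * (((cmod z)\<^sup>2 + (cmod w)\<^sup>2) / 2)"
    unfolding power2_eq_square[of "s 0"]
    using ab \<open>0 < n\<close> by (intro mult_right_mono mult_mono s_decreasing s_nonneg) auto
  finally show "1 * (s a * s b) * Re (z * cnj w) \<le> (s 0)\<^sup>2 * ((cmod z)\<^sup>2 + (cmod w)\<^sup>2) / 2" by simp
qed (use eig in simp_all)

lemma compressed_eigen_le_product:
  assumes V: "V \<in> carrier_mat m k" "mat_adjoint V * V = 1\<^sub>m k" and n: "1 < n"
    and eig: "twisted_eigen (- 1) (mat_adjoint V * B) (of_real \<mu>)"
  shows "\<mu> \<le> s 0 * s 1"
proof (rule compressed_eigen_le[OF V, of "- 1"])
  have nn: "0 \<le> s 0 * s 1" using n by (intro mult_nonneg_nonneg s_nonneg) auto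
  then show "0 \<le> s 0 * s 1" .
  fix a b :: nat and z w :: complex assume ab: "a < n" "b < n" and zw: "a = b \<Longrightarrow> z = w"
  \<comment> \<open>Of two distinct indices at least one is positive, so its factor is at most
    \<open>s 1\<close>.\<close>
  have prod: "s a * s b \<le> s 0 * s 1" if "a \<noteq> b"
  proof (cases "a = 0")
    case True
    then show ?thesis using that ab n by (intro mult_mono s_decreasing s_nonneg) auto
  next
    case False
    hence "s a * s b \<le> s 1 * s 0" using ab n by (intro mult_mono s_decreasing s_nonneg) auto
    then show ?thesis by (simp add: mult.commute)
  qed
  show "- 1 * (s a * s b) * Re (z * cnj w) \<le> s 0 * s 1 * ((cmod z)\<^sup>2 + (cmod w)\<^sup>2) / 2"
  proof (cases "a = b")
    case True
    have "- 1 * (s a * s b) * Re (z * cnj w) = - ((s a)\<^sup>2 * (cmod z)\<^sup>2)"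
      using zw[OF True] True unfolding cmod_power2 by (simp add: power2_eq_square)
    also have "\<dots> \<le> 0" by simp
    also have "0 \<le> s 0 * s 1 * ((cmod z)\<^sup>2 + (cmod w)\<^sup>2) / 2" using nn by simp
    finally show ?thesis .
  next
    case False
    have "- 1 * (s a * s b) * Re (z * cnj w) = s a * s b * (- Re (z * cnj w))" by (simp only: mult_minus_left mult_minus_right mult_1)
    also have "\<dots> \<le> s a * s b * (((cmod z)\<^sup>2 + (cmod w)\<^sup>2) / 2)"
      using ab abs_le_D2[OF abs_Re_mult_cnj_le] by (intro mult_left_mono mult_nonneg_nonneg s_nonneg)
    also have "\<dots> \<le> s 0 * s 1 * (((cmod z)\<^sup>2 + (cmod w)\<^sup>2) / 2)"
      using prod[OF False] by (intro mult_right_mono) auto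
    finally show ?thesis by simp
  qed
qed (use eig in simp_all)

text \<open>\<open>V\<close> starts with the first \<open>t\<close> columns of \<open>W\<close>,
  orthonormal because their singular values are nonzero. The entries with both indices at least
  \<open>t\<close> depend on the chosen extension and stay unspecified.\<close>

lemma adapted_isometry:
  assumes "t \<le> k" "k \<le> m" "t \<le> n" and pos: "\<And>b. b < t \<Longrightarrow> s b \<noteq> 0"
  shows "\<exists>V \<in> carrier_mat m k. mat_adjoint V * V = 1\<^sub>m k \<and>
    (\<forall>r<k. \<forall>b<n. r < t \<or> b < t \<longrightarrow> (mat_adjoint V * B * U) $$ (r, b) = (if r = b then of_real (s b) else 0))"
proof -
  define V0 where "V0 = mat m t (\<lambda>(r, b). W $$ (r, b))"
  have V0: "V0 \<in> carrier_mat m t" by (simp add: V0_def)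
  have "mat_adjoint V0 * V0 = 1\<^sub>m t"
  proof (rule eq_matI)
    fix a b assume "a < dim_row (1\<^sub>m t :: complex mat)" "b < dim_col (1\<^sub>m t :: complex mat)"
    hence ab: "a < t" "b < t" by auto
    have "(mat_adjoint V0 * V0) $$ (a, b) = (\<Sum>r<m. cnj (W $$ (r, a)) * W $$ (r, b))"
      using V0 ab by (simp add: index_adjoint_mult V0_def del: index_mult_mat(1))
    also have "\<dots> = (if a = b then 1 else 0)" using ab assms by (simp add: WW)
    finally show "(mat_adjoint V0 * V0) $$ (a, b) = 1\<^sub>m t $$ (a, b)" using ab by simp
  qed (use V0 in auto)
  from isometry_extension[OF assms(1,2) V0 this] obtain V where
    V: "V \<in> carrier_mat m k" "mat_adjoint V * V = 1\<^sub>m k" "\<And>l i. l < m \<Longrightarrow> i < t \<Longrightarrow> V $$ (l, i) = W $$ (l, i)"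
    by (auto simp: V0_def)
  have "(mat_adjoint V * B * U) $$ (r, b) = (if r = b then of_real (s b) else 0)"
    if rb: "r < k" "b < n" "r < t \<or> b < t" for r b
  proof -
    have VW: "(mat_adjoint V * W) $$ (r, b) = (\<Sum>l<m. cnj (V $$ (l, r)) * W $$ (l, b))"
      using V W rb by (simp add: index_adjoint_mult del: index_mult_mat(1))
    show ?thesis
    proof (cases "r < t")
      case True
      hence "(mat_adjoint V * W) $$ (r, b) = (\<Sum>l<m. cnj (W $$ (l, r)) * W $$ (l, b))"
        unfolding VW by (simp add: V(3))
      also have "\<dots> = (if r = b then 1 else 0)" using True rb assms by (simp add: WW)
      finally show ?thesis using index_compressed[OF V(1) rb(1,2)] by simp
    next
      \<comment> \<open>Beyond the prescribed rows, column \<open>b\<close> of \<open>W\<close> is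
        still a column of \<open>V\<close>, so orthogonality within \<open>V\<close> gives the
        entry.\<close>
      case False
      hence b: "b < t" using rb by simp
      have "(mat_adjoint V * W) $$ (r, b) = (\<Sum>l<m. cnj (V $$ (l, r)) * V $$ (l, b))"
        unfolding VW using b by (simp add: V(3))
      also have "\<dots> = (mat_adjoint V * V) $$ (r, b)"
        using V rb b assms by (subst index_adjoint_mult) auto
      also have "\<dots> = (if r = b then 1 else 0)" unfolding V(2) using rb b assms by simp
      finally show ?thesis using index_compressed[OF V(1) rb(1,2)] by simp
    qed
  qed
  with V(1,2) show ?thesis by blast
qed

text \<open>Otherwise columns 0 and 1 of \<open>W\<close> would be orthogonal unit vectors that are
  both multiples of the same vector \<open>f\<close>.\<close>

lemma second_singular_value_rank_le_1:
  assumes "vec_space.rank m B \<le> 1" and n: "1 < n"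
  shows "s 1 = 0"
proof (rule ccontr)
  assume s1: "s 1 \<noteq> 0"
  hence s0: "s 0 \<noteq> 0" using s_decreasing[of 0 1] s_nonneg[of 1] n by auto
  obtain f g where fg: "\<And>r j. r < m \<Longrightarrow> j < n \<Longrightarrow> B $$ (r, j) = f r * g j"
    using vec_space.rank_le_1_factorization[OF B assms(1)] by auto
  define h where "h b = (\<Sum>j<n. g j * U $$ (j, b)) / of_real (s b)" for b
  define N where "N = (\<Sum>r<m. cnj (f r) * f r)"
  have Wfh: "W $$ (r, b) = f r * h b" if "r < m" "b < n" "s b \<noteq> 0" for r b
  proof -
    have "(B * U) $$ (r, b) = f r * (\<Sum>j<n. g j * U $$ (j, b))"
      using B U that by (simp add: index_mult_mat_sum fg sum_distrib_left mult.assoc del: index_mult_mat(1))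
    then show ?thesis using BU[OF that(1,2)] that(3) by (simp add: h_def field_simps del: index_mult_mat(1))
  qed
  have WWh: "(\<Sum>r<m. cnj (W $$ (r, a)) * W $$ (r, b)) = cnj (h a) * h b * N"
    if "a < n" "b < n" "s a \<noteq> 0" "s b \<noteq> 0" for a b
    unfolding N_def sum_distrib_left using that by (intro sum.cong) (auto simp: Wfh)
  show False
    using WWh[of 0 0] WWh[of 1 1] WWh[of 0 1] WW[of 0 0] WW[of 1 1] WW[of 0 1] s0 s1 n by auto
qed

end

section \<open>From eigenvalue bounds to the maximum over isometries\<close>

lemma compression_carrier:
  assumes "V \<in> carrier_mat m k"
  shows "mat_adjoint (kronecker (1\<^sub>m n) V) * partial_transpose n m A * kronecker (1\<^sub>m n) V
           \<in> carrier_mat (n * k) (n * k)"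
  by (rule carrier_matI) (use assms in \<open>auto simp: kronecker_def\<close>)

lemma lambda_max_compression:
  fixes B V :: "complex mat" and e :: real
  assumes B: "B \<in> carrier_mat m n" and V: "V \<in> carrier_mat m k" and "0 < n" "0 < k"
  defines "E \<equiv> {r. twisted_eigen (of_real e) (mat_adjoint V * B) (of_real r)}"
  shows "lambda_max (mat_adjoint (kronecker (1\<^sub>m n) V)
           * partial_transpose n m (of_real e \<cdot>\<^sub>m outer_self (vec_of_mat B)) * kronecker (1\<^sub>m n) V) = Max E"
    and "finite E" "E \<noteq> {}"
proof -
  let ?H = "mat_adjoint (kronecker (1\<^sub>m n) V)
           * partial_transpose n m (of_real e \<cdot>\<^sub>m outer_self (vec_of_mat B)) * kronecker (1\<^sub>m n) V"
  note H = compression_carrier[OF V, of n "of_real e \<cdot>\<^sub>m outer_self (vec_of_mat B)"]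
  note iff = eigenvalue_compression_iff[OF B V, of "of_real e"]
  show "lambda_max ?H = Max E" unfolding lambda_max_def iff E_def ..
  have "of_real ` E \<subseteq> spectrum ?H" unfolding spectrum_def E_def iff by auto
  hence "finite (complex_of_real ` E)" using card_finite_spectrum(1)[OF H] finite_subset by blast
  then show "finite E" by (rule finite_imageD) (simp add: inj_on_def)
  \<comment> \<open>Positive size guarantees a complex eigenvalue, and
    \<open>twisted_eigen_real\<close> places it in \<open>E\<close>.\<close>
  have "spectrum ?H \<noteq> {}" using spectrum_non_empty[OF H] assms(3,4) by simp
  then obtain \<mu> where mu: "twisted_eigen (of_real e) (mat_adjoint V * B) \<mu>"
    unfolding spectrum_def iff by auto
  with twisted_eigen_real[OF mu] show "E \<noteq> {}" unfolding E_def by (auto elim!: Reals_cases)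
qed

text \<open>Reduces each maximum to two tasks: an isometry with eigenvalue \<open>c\<close>, and the
  bound \<open>c\<close> for all real eigenvalues of all isometries. The witness
  \<open>V\<^sub>0\<close> itself shows that the maximum exists.\<close>

lemma gamma_max_eqI:
  fixes B V\<^sub>0 :: "complex mat" and c e :: real
  assumes B: "B \<in> carrier_mat m n" and "0 < n" "0 < k"
    and V0: "V\<^sub>0 \<in> carrier_mat m k" "mat_adjoint V\<^sub>0 * V\<^sub>0 = 1\<^sub>m k"
    and eig: "twisted_eigen (of_real e) (mat_adjoint V\<^sub>0 * B) (of_real c)"
    and le: "\<And>V \<mu>. V \<in> carrier_mat m k \<Longrightarrow> mat_adjoint V * V = 1\<^sub>m k \<Longrightarrow>
      twisted_eigen (of_real e) (mat_adjoint V * B) (of_real \<mu>) \<Longrightarrow> \<mu> \<le> c"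
  shows "gamma_max m n k (of_real e \<cdot>\<^sub>m outer_self (vec_of_mat B)) = c"
  unfolding gamma_max_def
proof (rule Greatest_equality)
  note lm = lambda_max_compression[OF B _ assms(2,3), of _ e]
  have "Max {r. twisted_eigen (of_real e) (mat_adjoint V\<^sub>0 * B) (of_real r)} = c"
    by (rule Max_eqI) (use lm(2)[OF V0(1)] eig le[OF V0] in auto)
  then show "\<exists>V \<in> carrier_mat m k. mat_adjoint V * V = 1\<^sub>m k \<and>
     c = lambda_max (mat_adjoint (kronecker (1\<^sub>m n) V)
           * partial_transpose n m (of_real e \<cdot>\<^sub>m outer_self (vec_of_mat B)) * kronecker (1\<^sub>m n) V)"
    using V0 lm(1)[OF V0(1)] by (intro bexI[of _ V\<^sub>0]) auto
next
  note lm = lambda_max_compression[OF B _ assms(2,3), of _ e]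
  fix x assume "\<exists>V \<in> carrier_mat m k. mat_adjoint V * V = 1\<^sub>m k \<and>
     x = lambda_max (mat_adjoint (kronecker (1\<^sub>m n) V)
           * partial_transpose n m (of_real e \<cdot>\<^sub>m outer_self (vec_of_mat B)) * kronecker (1\<^sub>m n) V)"
  then obtain V where V: "V \<in> carrier_mat m k" "mat_adjoint V * V = 1\<^sub>m k"
    and x: "x = Max {r. twisted_eigen (of_real e) (mat_adjoint V * B) (of_real r)}"
    using lm(1) by auto
  show "x \<le> c" unfolding x using lm(2,3)[OF V(1)] le[OF V] by (subst Max_le_iff) auto
qed

section \<open>Evaluation of both maxima\<close>

context singular_decomposition
begin

lemma compressed_carrier: "V \<in> carrier_mat m k \<Longrightarrow> mat_adjoint V * B \<in> carrier_mat k n"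
  by (intro mult_carrier_mat[OF _ B] mat_adjoint_carrier)

lemma gamma_minus_eq:
  assumes "0 < n" "1 \<le> k" "k \<le> m"
  shows "gamma_minus k B = (s 0)\<^sup>2"
proof -
  \<comment> \<open>If \<open>s 0 = 0\<close>, column 0 of \<open>W\<close> is zero and cannot start
    an isometry; then any \<open>V\<close> attains the value 0.\<close>
  define t :: nat where "t = (if s 0 = 0 then 0 else 1)"
  have t: "t \<le> k" "t \<le> n" and ts: "\<And>b. b < t \<Longrightarrow> s b \<noteq> 0"
    using assms by (auto simp: t_def split: if_splits)
  obtain V where V: "V \<in> carrier_mat m k" "mat_adjoint V * V = 1\<^sub>m k"
    and F: "\<And>r b. r < k \<Longrightarrow> b < n \<Longrightarrow> r < t \<or> b < t \<Longrightarrow>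
      (mat_adjoint V * B * U) $$ (r, b) = (if r = b then of_real (s b) else 0)"
    using adapted_isometry[OF t(1) assms(3) t(2) ts] by blast
  have Fc: "mat_adjoint V * B * U \<in> carrier_mat k n" by (rule mult_carrier_mat[OF compressed_carrier[OF V(1)] U(1)])
  have "twisted_eigen 1 (mat_adjoint V * B * U) (of_real ((s 0)\<^sup>2))"
  proof (cases "s 0 = 0")
    case True
    have "twisted_eigen 1 (mat_adjoint V * B * U) 0"
      by (rule twisted_eigen_zero_col[OF Fc, of 0])
         (use assms index_compressed[OF V(1), of _ 0] True in \<open>auto simp del: index_mult_mat(1)\<close>)
    then show ?thesis using True by simp
  next
    case False
    show ?thesis
      by (rule twisted_eigen_square[OF Fc]) (use False assms F in \<open>auto simp: t_def simp del: index_mult_mat(1)\<close>)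
  qed
  hence eig: "twisted_eigen 1 (mat_adjoint V * B) (of_real ((s 0)\<^sup>2))"
    using twisted_eigen_mult_unitary_iff[OF compressed_carrier[OF V(1)] U] by blast
  have "gamma_max m n k (of_real 1 \<cdot>\<^sub>m outer_self (vec_of_mat B)) = (s 0)\<^sup>2"
    by (rule gamma_max_eqI[OF B _ _ V]) (use assms eig compressed_eigen_le_square in auto)
  moreover have "of_real 1 \<cdot>\<^sub>m outer_self (vec_of_mat B) = outer_self (vec_of_mat B)"
    by (rule eq_matI) auto
  ultimately show ?thesis using B by (simp add: gamma_minus_def)
qed

lemma gamma_plus_eq:
  assumes n: "1 < n" and k: "1 \<le> k" "k \<le> m"
  shows "gamma_plus k B = (if k = 1 then 0 else s 0 * s 1)"
proof -
  \<comment> \<open>Two singular columns are prescribed when both fit and the product is nonzero.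
    For \<open>k = 1\<close> only one fits, and for \<open>s 1 = 0\<close> any isometry attains the
    value 0.\<close>
  define t :: nat where "t = (if s 1 = 0 then 0 else if k = 1 then 1 else 2)"
  have s0: "s 1 \<noteq> 0 \<Longrightarrow> s 0 \<noteq> 0" using s_decreasing[of 0 1] s_nonneg[of 1] n by auto
  have t: "t \<le> k" "t \<le> n" using n k by (auto simp: t_def)
  have ts: "b < t \<Longrightarrow> s b \<noteq> 0" for b
    using s0 by (cases b) (auto simp: t_def less_Suc_eq split: if_splits)
  obtain V where V: "V \<in> carrier_mat m k" "mat_adjoint V * V = 1\<^sub>m k"
    and F: "\<And>r b. r < k \<Longrightarrow> b < n \<Longrightarrow> r < t \<or> b < t \<Longrightarrow>
      (mat_adjoint V * B * U) $$ (r, b) = (if r = b then of_real (s b) else 0)"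
    using adapted_isometry[OF t(1) k(2) t(2) ts] by blast
  have Fc: "mat_adjoint V * B * U \<in> carrier_mat k n" by (rule mult_carrier_mat[OF compressed_carrier[OF V(1)] U(1)])
  have "twisted_eigen (- 1) (mat_adjoint V * B * U) (of_real (if k = 1 then 0 else s 0 * s 1))"
  proof (cases "s 1 = 0 \<or> k = 1")
    case True
    \<comment> \<open>Column 1 vanishes either through its factor \<open>s 1\<close>, or because for
      \<open>k = 1\<close> the only row is the prescribed row 0, zero off the diagonal.\<close>
    have "(mat_adjoint V * B * U) $$ (r, 1) = 0" if "r < k" for r
    proof (cases "s 1 = 0")
      case True
      then show ?thesis using index_compressed[OF V(1) that n] by simp
    next
      case False
      then show ?thesis using True F[of r 1] that n by (simp add: t_def del: index_mult_mat(1))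
    qed
    hence "twisted_eigen (- 1) (mat_adjoint V * B * U) 0"
      by (intro twisted_eigen_zero_col[OF Fc n]) (use k in auto)
    moreover have "(if k = 1 then 0 else s 0 * s 1) = 0" using True by auto
    ultimately show ?thesis by simp
  next
    case False
    hence "t = 2" by (simp add: t_def)
    have "twisted_eigen (- 1) (mat_adjoint V * B * U) (of_real (s 0 * s 1))"
      by (rule twisted_eigen_product[OF Fc n])
         (use False k n F in \<open>auto simp: \<open>t = 2\<close> simp del: index_mult_mat(1)\<close>)
    then show ?thesis using False by simp
  qed
  hence eig: "twisted_eigen (- 1) (mat_adjoint V * B) (of_real (if k = 1 then 0 else s 0 * s 1))"
    using twisted_eigen_mult_unitary_iff[OF compressed_carrier[OF V(1)] U] by blast
  have "gamma_max m n k (of_real (- 1) \<cdot>\<^sub>m outer_self (vec_of_mat B)) = (if k = 1 then 0 else s 0 * s 1)"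
  proof (rule gamma_max_eqI[OF B _ _ V])
    fix V' \<mu> assume V': "V' \<in> carrier_mat m k" "mat_adjoint V' * V' = 1\<^sub>m k"
      and "twisted_eigen (of_real (- 1)) (mat_adjoint V' * B) (of_real \<mu>)"
    hence eig': "twisted_eigen (- 1) (mat_adjoint V' * B) (of_real \<mu>)" by simp
    show "\<mu> \<le> (if k = 1 then 0 else s 0 * s 1)"
    proof (cases "k = 1")
      case True
      then show ?thesis using twisted_eigen_row_nonpos[OF _ eig'] compressed_carrier[OF V'(1)] by simp
    next
      case False
      then show ?thesis using compressed_eigen_le_product[OF V' n eig'] by simp
    qed
  qed (use n k eig in auto)
  moreover have "of_real (- 1) \<cdot>\<^sub>m outer_self (vec_of_mat B) = - outer_self (vec_of_mat B)"
    by (rule eq_matI) auto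
  ultimately show ?thesis using B by (simp add: gamma_plus_def)
qed

end

theorem theorem4p8:
  fixes m n k :: nat and B :: "complex mat"
  assumes "m \<ge> 1" and "n \<ge> 1" and "1 \<le> k" and "k \<le> m"
    and "B \<in> carrier_mat m n"
  shows "(m \<ge> 2 \<and> n \<ge> 2 \<longrightarrow>
            gamma_plus k B = (if k = 1 \<or> vec_space.rank m B \<le> 1 then 0
                              else singular_value B 1 * singular_value B 2))
         \<and> gamma_minus k B = (singular_value B 1)\<^sup>2"
proof -
  obtain U W s where "singular_decomposition m n B U W s"
    and sv: "\<And>i. i < m \<Longrightarrow> i < n \<Longrightarrow> singular_value B (Suc i) = s i"
    using singular_decomposition_exists[OF assms(5)] by blast
  then interpret singular_decomposition m n B U W s by simp
  have "gamma_plus k B = (if k = 1 \<or> vec_space.rank m B \<le> 1 then 0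
                          else singular_value B 1 * singular_value B 2)" if "m \<ge> 2" "n \<ge> 2"
    \<comment> \<open>Rank at most 1 enters only through \<open>s 1 = 0\<close>, which annihilates
      the product; the 1-based singular values 1 and 2 are \<open>s 0\<close> and
      \<open>s 1\<close>.\<close>
    using gamma_plus_eq[of k] second_singular_value_rank_le_1 sv[of 0] sv[of 1] assms that
    by (auto simp: numeral_2_eq_2)
  moreover have "gamma_minus k B = (singular_value B 1)\<^sup>2"
    using gamma_minus_eq[of k] sv[of 0] assms by simp
  ultimately show ?thesis by blast
qed

end
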